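(* The Fuchsian type property does not depend on the choice of (formal or holomorphic) admissible coordinates. That is: let $M$ be a hypersurface through the origin of $\mathbb{C}^2$ given in admissible form, and let $H$ be a formal or holomorphic invertible coordinate change at the origin of $\mathbb{C}^2$, $H(0)=0$, which transforms $M$ into a hypersurface $M^*$ that is again given in admissible form. Then $M$ is of Fuchsian type if and only if $M^*$ is of Fuchsian type.
   Context: Write $(z,w)$, $w=u+iv$, for the coordinates of $\mathbb{C}^2$. A hypersurface is in admissible form if it is given near the origin by $$v=\tfrac12 u^m\Big(\epsilon|z|^2+\sum_{k,l\ge 2}h_{kl}(u)z^k\bar z^l\Big),\qquad \epsilon=\pm1,$$ with an integer $m\ge 1$ and real-valued right-hand side. The original hypersurface $M$ is real-analytic (convergent right-hand side); after a formal coordinate change the equation of $M^*$ is understood as a formal power series equation satisfying the reality condition. The integer $m$, the nonminimality order, is an invariant of the hypersurface. Let $\mathrm{ord}\,h_{kl}(w)$ be the order of vanishing at $0$ of the power series $h_{kl}(w)$ (with $\mathrm{ord}\,0=+\infty$). A hypersurface in admissible form is of Fuchsian type if - $\mathrm{ord}\,h_{22}\ge m-1$, $\mathrm{ord}\,h_{23}\ge 2m-2$, $\mathrm{ord}\,h_{33}\ge 2m-2$; - $\mathrm{ord}\,h_{2l}\ge 2m-l+2$ for $4\le l\le 2m+1$; - $\mathrm{ord}\,h_{kl}\ge 2m-k-l+5$ for $k\ge3$, $l\ge 3$, $7\le k+l\le 2m+4$. A formal invertible coordinate change is a pair $H$ of formal power series in $(z,w)$ with complex coefficients, without constant term, with invertible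 Jacobian matrix at $0$. It transforms $M$ into $M^*$ if, for the respective defining functions $\rho,\rho^*$ (that is, $\rho=v-\tfrac12 u^m\big(\epsilon|z|^2+\sum_{k,l\ge 2}h_{kl}(u)z^k\bar z^l\big)$ with the $\epsilon$ and $h_{kl}$ of $M$, and $\rho^*$ the same expression with the $\epsilon$ and $h_{kl}$ of $M^*$), $\rho^*(H(Z),\overline{H(Z)})=a(Z,\bar Z)\rho(Z,\bar Z)$ as formal power series, for some formal power series $a$. *)

theory Defs
  imports
    Complex_Main
    "HOL-Computational_Algebra.Formal_Power_Series"
    "HOL-Library.Groups_Big_Fun"
    "HOL-Library.Extended_Nat"
    "HOL-Analysis.Infinite_Sum"
begin

unbundle fps_syntax

text \<open>
  Formal power series in \<open>(z, w)\<close> are represented by the iterated type \<open>complex fps fps\<close>, the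
  coefficient of \<open>z^i w^j\<close> in \<open>f\<close> being \<open>f $ i $ j\<close>.  Formal power series in
  \<open>(Z, cnj Z) = (z, w, cnj z, cnj w)\<close>, regarded as four independent variables, are elements of the
  iterated type below, with the variables in this order from the outermost to the innermost layer.
\<close>

type_synonym fps2 = "complex fps fps"
type_synonym fps4 = "complex fps fps fps fps"

definition coeff4 :: "fps4 \<Rightarrow> nat \<Rightarrow> nat \<Rightarrow> nat \<Rightarrow> nat \<Rightarrow> complex"
  where "coeff4 F i j k l = F $ i $ j $ k $ l"

definition const4 :: "complex \<Rightarrow> fps4"
  where "const4 c = fps_const (fps_const (fps_const (fps_const c)))"

definition var_z :: fps4 where "var_z = fps_X"
definition var_w :: fps4 where "var_w = fps_const fps_X"
definition var_zbar :: fps4 where "var_zbar = fps_const (fps_const fps_X)"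
definition var_wbar :: fps4 where "var_wbar = fps_const (fps_const (fps_const fps_X))"

definition var_u :: fps4 where "var_u = const4 (1 / 2) * (var_w + var_wbar)"
definition var_v :: fps4 where "var_v = const4 (1 / (2 * \<i>)) * (var_w - var_wbar)"

text \<open>
  The sum of a family of power series is taken coefficientwise.  It is meaningful for families in
  which every monomial occurs with a nonzero coefficient in only finitely many members;
  \<^const>\<open>Sum_any\<close> yields \<open>0\<close> on the other ones.  All families below have this property
  (for \<open>substitute4\<close>, when the substituted series have no constant term).
\<close>

definition formal_sum :: "('i \<Rightarrow> fps4) \<Rightarrow> fps4"
  where "formal_sum F =
    Abs_fps (\<lambda>i. Abs_fps (\<lambda>j. Abs_fps (\<lambda>k. Abs_fps (\<lambda>l. Sum_any (\<lambda>x. coeff4 (F x) i j k l)))))"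

definition substitute4 :: "fps4 \<Rightarrow> fps4 \<Rightarrow> fps4 \<Rightarrow> fps4 \<Rightarrow> fps4 \<Rightarrow> fps4"
  where "substitute4 F A B C D =
    formal_sum (\<lambda>(i, j, k, l). const4 (coeff4 F i j k l) * A ^ i * B ^ j * C ^ k * D ^ l)"

text \<open>The series \<open>f(Z)\<close> and \<open>cnj (f(Z))\<close>.\<close>

definition holo :: "fps2 \<Rightarrow> fps4"
  where "holo f = formal_sum (\<lambda>(i, j). const4 (f $ i $ j) * var_z ^ i * var_w ^ j)"

definition antiholo :: "fps2 \<Rightarrow> fps4"
  where "antiholo f = formal_sum (\<lambda>(i, j). const4 (cnj (f $ i $ j)) * var_zbar ^ i * var_wbar ^ j)"

text \<open>Conjugation of a series in \<open>(Z, cnj Z)\<close> conjugates its coefficients and exchanges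
  \<open>Z\<close> and \<open>cnj Z\<close>.\<close>

definition real_series :: "fps4 \<Rightarrow> bool"
  where "real_series F \<longleftrightarrow> (\<forall>i j k l. coeff4 F k l i j = cnj (coeff4 F i j k l))"

definition convergent_series :: "fps4 \<Rightarrow> bool"
  where "convergent_series F \<longleftrightarrow>
    (\<exists>r>0. (\<lambda>(i, j, k, l). norm (coeff4 F i j k l) * r ^ (i + j + k + l)) summable_on UNIV)"

text \<open>
  A hypersurface in admissible form is given by \<open>m\<close>, \<open>\<epsilon>\<close> and the family \<open>h\<close>; the values of \<open>h k l\<close>
  with \<open>k < 2\<close> or \<open>l < 2\<close> play no role.
\<close>

definition subst_u :: "complex fps \<Rightarrow> fps4"
  where "subst_u g = formal_sum (\<lambda>j. const4 (g $ j) * var_u ^ j)"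

definition admissible_rhs :: "nat \<Rightarrow> real \<Rightarrow> (nat \<Rightarrow> nat \<Rightarrow> complex fps) \<Rightarrow> fps4"
  where "admissible_rhs m \<epsilon> h =
    const4 (1 / 2) * var_u ^ m *
      (const4 (of_real \<epsilon>) * var_z * var_zbar +
       formal_sum (\<lambda>(k, l). if k \<ge> 2 \<and> l \<ge> 2
         then subst_u (h k l) * var_z ^ k * var_zbar ^ l else 0))"

definition defining_function :: "nat \<Rightarrow> real \<Rightarrow> (nat \<Rightarrow> nat \<Rightarrow> complex fps) \<Rightarrow> fps4"
  where "defining_function m \<epsilon> h = var_v - admissible_rhs m \<epsilon> h"

definition admissible_form :: "nat \<Rightarrow> real \<Rightarrow> (nat \<Rightarrow> nat \<Rightarrow> complex fps) \<Rightarrow> bool"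
  where "admissible_form m \<epsilon> h \<longleftrightarrow>
    m \<ge> 1 \<and> (\<epsilon> = 1 \<or> \<epsilon> = -1) \<and> real_series (admissible_rhs m \<epsilon> h)"

definition vanishing_order :: "complex fps \<Rightarrow> enat"
  where "vanishing_order f = (if f = 0 then \<infinity> else enat (subdegree f))"

text \<open>In the given ranges of \<open>m\<close>, \<open>k\<close>, \<open>l\<close> none of the subtractions is truncated.\<close>

definition fuchsian_type :: "nat \<Rightarrow> (nat \<Rightarrow> nat \<Rightarrow> complex fps) \<Rightarrow> bool"
  where "fuchsian_type m h \<longleftrightarrow>
    vanishing_order (h 2 2) \<ge> enat (m - 1) \<and>
    vanishing_order (h 2 3) \<ge> enat (2 * m - 2) \<and>
    vanishing_order (h 3 3) \<ge> enat (2 * m - 2) \<and>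
    (\<forall>l. 4 \<le> l \<and> l \<le> 2 * m + 1 \<longrightarrow> vanishing_order (h 2 l) \<ge> enat (2 * m + 2 - l)) \<and>
    (\<forall>k l. k \<ge> 3 \<and> l \<ge> 3 \<and> 7 \<le> k + l \<and> k + l \<le> 2 * m + 4 \<longrightarrow>
       vanishing_order (h k l) \<ge> enat (2 * m + 5 - (k + l)))"

text \<open>
  A holomorphic coordinate change enters through its Taylor series at the origin.
  The last condition is invertibility of the Jacobian matrix at the origin.
\<close>

definition formal_coordinate_change :: "fps2 \<times> fps2 \<Rightarrow> bool"
  where "formal_coordinate_change H \<longleftrightarrow> (case H of (f, g) \<Rightarrow>
    f $ 0 $ 0 = 0 \<and> g $ 0 $ 0 = 0 \<and>
    f $ 1 $ 0 * g $ 0 $ 1 - f $ 0 $ 1 * g $ 1 $ 0 \<noteq> 0)"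

definition transforms :: "fps2 \<times> fps2 \<Rightarrow> fps4 \<Rightarrow> fps4 \<Rightarrow> bool"
  where "transforms H \<rho> \<rho>' \<longleftrightarrow> (case H of (f, g) \<Rightarrow>
    \<exists>a. substitute4 \<rho>' (holo f) (holo g) (antiholo f) (antiholo g) = a * \<rho>)"

end

theory Submission
  imports Defs
begin

text \<open>
  Parametrise the complexified hypersurface by \<open>z\<close>, \<open>cnj z\<close> and the real coordinate \<open>u\<close>, so that
  \<open>w = u + (\<i>/2) u^m R\<close>, where \<open>R = \<epsilon>|z|^2 + \<Sum> h\<^sub>k\<^sub>l z^k cnj z^l\<close>.  A map \<open>(f, g)\<close> between two such
  hypersurfaces then satisfies \<open>Im g = (1/2) (Re g)^m R'(f, cnj f, Re g)\<close>, an identity of power series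
  in \<open>(z, cnj z, u)\<close>.  Its terms without \<open>cnj z\<close> show \<open>g = q(w) + O(w^(m+1))\<close>, and its terms linear
  in \<open>cnj z\<close> bound the part of \<open>f\<close> that is nonlinear in \<open>z\<close> by the coefficients \<open>h'\<close>.

  Give \<open>z\<close> and \<open>cnj z\<close> the weight \<open>1\<close> and \<open>u\<close> the weight \<open>2\<close>.  Suppose that neither hypersurface has a
  coefficient forbidden by the Fuchsian conditions in weights below \<open>e\<close>.  Up to terms with at most
  one factor \<open>z\<close> or at most one factor \<open>cnj z\<close>, and up to permitted monomials, the nonlinearity of
  the map does not contribute to weight \<open>e\<close>; comparing the coefficients of a forbidden monomial
  \<open>z^k cnj z^l u^n\<close> of weight \<open>e\<close> shows that \<open>h\<^sub>k\<^sub>l\<close> and \<open>h'\<^sub>k\<^sub>l\<close> have proportional \<open>n\<close>-th coefficients, with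
  a nonzero factor.  Hence, by induction on \<open>e\<close>, both hypersurfaces are Fuchsian or neither is.
\<close>

subsection \<open>Substitution homomorphisms\<close>

declare split_paired_All [simp del] split_paired_Ex [simp del]

type_synonym mon4 = "nat \<times> nat \<times> nat \<times> nat"

definition coef :: "fps4 \<Rightarrow> mon4 \<Rightarrow> complex"
  where "coef F = (\<lambda>(i, j, k, l). coeff4 F i j k l)"

definition deg4 :: "mon4 \<Rightarrow> nat"
  where "deg4 = (\<lambda>(i, j, k, l). i + j + k + l)"

definition mon_below :: "mon4 \<Rightarrow> mon4 set"
  where "mon_below = (\<lambda>(i, j, k, l). {0..i} \<times> {0..j} \<times> {0..k} \<times> {0..l})"

lemma deg4_add: "deg4 (a + b) = deg4 a + deg4 b"
  by (auto simp: deg4_def split: prod.splits)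

lemma deg4_le: "deg4 b \<le> deg4 (b + c)" "deg4 c \<le> deg4 (b + c)"
  by (simp_all add: deg4_add)

lemma finite_deg4: "finite {a. deg4 a \<le> n}"
proof (rule finite_subset)
  show "{a. deg4 a \<le> n} \<subseteq> {..n} \<times> {..n} \<times> {..n} \<times> {..n}"
    by (auto simp: deg4_def)
qed auto

lemma finite_deg4_less: "finite {a. deg4 a < n}"
  by (rule finite_subset[OF _ finite_deg4[of n]]) auto

lemma fps4_eqI:
  assumes "\<And>a. coef F a = coef G a"
  shows "F = G"
proof (intro fps_ext)
  fix i j k l
  show "F $ i $ j $ k $ l = G $ i $ j $ k $ l"
    using assms[of "(i, j, k, l)"] by (simp add: coef_def coeff4_def)
qed

lemma coef_0 [simp]: "coef 0 a = 0"
  and coef_add [simp]: "coef (F + G) a = coef F a + coef G a"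
  and coef_diff [simp]: "coef (F - G) a = coef F a - coef G a"
  and coef_const4_mult [simp]: "coef (const4 c * F) a = c * coef F a"
  by (auto simp: coef_def coeff4_def const4_def split: prod.splits)

lemma coef_double [simp]: "coef (2 * F) a = 2 * coef F a"
  by (metis coef_add mult_2)

lemma coef_sum [simp]: "coef (sum F X) a = (\<Sum>x\<in>X. coef (F x) a)"
  by (induction X rule: infinite_finite_induct) auto

lemma coef_const4: "coef (const4 c) a = (if a = (0, 0, 0, 0) then c else 0)"
  by (auto simp: coef_def coeff4_def const4_def split: prod.splits)

lemma coef_one: "coef 1 a = (if a = (0, 0, 0, 0) then 1 else 0)"
  using coef_const4[of 1 a] by (simp add: const4_def)

lemma coef_formal_sum: "coef (formal_sum F) a = Sum_any (\<lambda>x. coef (F x) a)"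
  by (auto simp: coef_def coeff4_def formal_sum_def split: prod.splits)

lemma coeff4_mult:
  "coeff4 (F * G) i j k l =
    (\<Sum>i'=0..i. \<Sum>j'=0..j. \<Sum>k'=0..k. \<Sum>l'=0..l.
      coeff4 F i' j' k' l' * coeff4 G (i - i') (j - j') (k - k') (l - l'))"
  by (simp add: coeff4_def fps_mult_nth fps_sum_nth)

lemma coef_mult: "coef (F * G) a = (\<Sum>b\<in>mon_below a. coef F b * coef G (a - b))"
  by (cases a) (simp add: coef_def mon_below_def coeff4_mult sum.cartesian_product' split_beta)

lemma mon_below_iff: "b \<in> mon_below a \<longleftrightarrow> (\<exists>c. a = b + c)"
proof
  assume "b \<in> mon_below a"
  then have "a = b + (a - b)"
    by (cases a; cases b) (auto simp: mon_below_def)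
  then show "\<exists>c. a = b + c" ..
qed (cases b, auto simp: mon_below_def)

lemma mon_add_diff: "(b + c) - b = (c :: mon4)"
  by (cases b; cases c) auto

text \<open>The nested convolutions of the iterated type become one sum over the decompositions of
  an exponent vector. All later product estimates go through this form.\<close>

lemma coef_mult_pairs:
  "coef (F * G) a = (\<Sum>(b, c) | b + c = a. coef F b * coef G c)"
proof -
  have "bij_betw (\<lambda>b. (b, a - b)) (mon_below a) {(b, c). b + c = a}"
  proof (rule bij_betwI[where g = fst])
    show "fst \<in> {(b, c). b + c = a} \<rightarrow> mon_below a"
      by (auto simp: mon_below_def)
  qed (auto simp: mon_below_iff mon_add_diff)
  from sum.reindex_bij_betw[OF this, of "\<lambda>(b, c). coef F b * coef G c"] show ?thesis
    by (simp add: coef_mult)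
qed

lemma finite_decompositions: "finite {(b, c). b + c = (a :: mon4)}"
  by (rule finite_subset[OF _ finite_cartesian_product[OF finite_deg4 finite_deg4],
        of _ "deg4 a" "deg4 a"]) (auto simp: deg4_def)

lemma coef_mult_cong:
  assumes "\<And>b c. b + c = a \<Longrightarrow> coef F b = coef F' b" "\<And>b c. b + c = a \<Longrightarrow> coef G c = coef G' c"
  shows "coef (F * G) a = coef (F' * G') a"
  unfolding coef_mult_pairs
proof (rule sum.cong[OF refl])
  fix x assume "x \<in> {(b, c). b + c = a}"
  then show "(case x of (b, c) \<Rightarrow> coef F b * coef G c) = (case x of (b, c) \<Rightarrow> coef F' b * coef G' c)"
    using assms[of "fst x" "snd x"] by (simp add: split_beta)
qed

lemma coef_mult_nonzero:
  assumes "coef (F * G) a \<noteq> 0"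
  obtains b c where "a = b + c" "coef F b \<noteq> 0" "coef G c \<noteq> 0"
proof -
  obtain x where "x \<in> {(b, c). b + c = a}" "(case x of (b, c) \<Rightarrow> coef F b * coef G c) \<noteq> 0"
    using assms unfolding coef_mult_pairs by (rule sum.not_neutral_contains_not_neutral)
  with that show thesis by (cases x) fastforce
qed

text \<open>When a single decomposition can contribute, the convolution collapses to one product.
  Single coefficients are isolated by this mechanism throughout the comparison.\<close>

lemma coef_mult_unique:
  assumes "\<And>b c. b + c = b' + c' \<Longrightarrow> coef F b \<noteq> 0 \<Longrightarrow> coef G c \<noteq> 0 \<Longrightarrow> b = b' \<and> c = c'"
  shows "coef (F * G) (b' + c') = coef F b' * coef G c'"
proof -
  have "coef (F * G) (b' + c') = (\<Sum>(b, c)\<in>{(b', c')}. coef F b * coef G c)"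
    unfolding coef_mult_pairs
  proof (rule sum.mono_neutral_right[OF finite_decompositions])
    show "\<forall>x\<in>{(b, c). b + c = b' + c'} - {(b', c')}. (case x of (b, c) \<Rightarrow> coef F b * coef G c) = 0"
    proof
      fix x assume "x \<in> {(b, c). b + c = b' + c'} - {(b', c')}"
      then show "(case x of (b, c) \<Rightarrow> coef F b * coef G c) = 0"
        using assms[of "fst x" "snd x"] by (cases x) auto
    qed
  qed auto
  then show ?thesis by simp
qed

subsection \<open>The filtration by total degree\<close>

text \<open>Membership in the \<open>D\<close>-th power of the maximal ideal, that is, the adic
  filtration in which formal sums converge.\<close>

definition vanish :: "nat \<Rightarrow> fps4 \<Rightarrow> bool"
  where "vanish D F \<longleftrightarrow> (\<forall>a. deg4 a < D \<longrightarrow> coef F a = 0)"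

lemma vanish_0 [simp]: "vanish 0 F"
  by (simp add: vanish_def)

lemma vanish_add: "vanish D F \<Longrightarrow> vanish D G \<Longrightarrow> vanish D (F + G)"
  and vanish_diff: "vanish D F \<Longrightarrow> vanish D G \<Longrightarrow> vanish D (F - G)"
  and vanish_const4_mult: "vanish D F \<Longrightarrow> vanish D (const4 c * F)"
  and vanish_mono: "vanish D F \<Longrightarrow> D' \<le> D \<Longrightarrow> vanish D' F"
  and vanish_formal_sum: "(\<And>x. vanish D (S x)) \<Longrightarrow> vanish D (formal_sum S)"
  by (auto simp: vanish_def coef_formal_sum)

lemma vanish_mult:
  assumes "vanish D F" "vanish E G"
  shows "vanish (D + E) (F * G)"
  unfolding vanish_def
proof (intro allI impI)
  fix a assume "deg4 a < D + E"
  then have "coef F b * coef G c = 0" if "b + c = a" for b c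
  proof (cases "deg4 b < D")
    case False
    then have "deg4 c < E" using that \<open>deg4 a < D + E\<close> deg4_add[of b c] by simp
    then show ?thesis using assms(2) unfolding vanish_def by simp
  qed (use assms(1) in \<open>simp add: vanish_def\<close>)
  then show "coef (F * G) a = 0"
    unfolding coef_mult_pairs by (intro sum.neutral) auto
qed

lemma vanish_power: "vanish D F \<Longrightarrow> vanish (n * D) (F ^ n)"
  by (induction n) (auto intro: vanish_mult)

lemma vanish_multI1: "vanish D F \<Longrightarrow> vanish D (F * G)"
  and vanish_multI2: "vanish D G \<Longrightarrow> vanish D (F * G)"
  using vanish_mult[of D F 0 G] vanish_mult[of 0 F D G] by auto

text \<open>The condition under which \<open>Sum_any\<close> computes genuine coefficients instead
  of its default value.\<close>

definition locally_finite :: "('i \<Rightarrow> fps4) \<Rightarrow> bool"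
  where "locally_finite S \<longleftrightarrow> (\<forall>a. finite {x. coef (S x) a \<noteq> 0})"

lemma locally_finiteI:
  assumes "\<And>x. vanish (d x) (S x)" "\<And>n. finite {x. d x \<le> n}"
  shows "locally_finite S"
  unfolding locally_finite_def
proof
  fix a
  have "{x. coef (S x) a \<noteq> 0} \<subseteq> {x. d x \<le> deg4 a}"
    using assms(1) by (auto simp: vanish_def not_less[symmetric])
  then show "finite {x. coef (S x) a \<noteq> 0}"
    using assms(2) finite_subset by blast
qed

text \<open>Continuity for the adic topology is imposed in the strong form that the filtration
  degree never drops.\<close>

definition continuous_hom :: "(fps4 \<Rightarrow> fps4) \<Rightarrow> bool"
  where "continuous_hom \<Psi> \<longleftrightarrow>
    (\<forall>F G. \<Psi> (F + G) = \<Psi> F + \<Psi> G) \<and> (\<forall>F G. \<Psi> (F * G) = \<Psi> F * \<Psi> G) \<and>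
    (\<forall>c. \<Psi> (const4 c) = const4 c) \<and> (\<forall>D F. vanish D F \<longrightarrow> vanish D (\<Psi> F))"

lemma const4_0: "const4 0 = 0" and const4_1: "const4 1 = 1"
  by (simp_all add: const4_def)

lemma
  assumes "continuous_hom \<Psi>"
  shows continuous_hom_add: "\<Psi> (F + G) = \<Psi> F + \<Psi> G"
    and continuous_hom_mult: "\<Psi> (F * G) = \<Psi> F * \<Psi> G"
    and continuous_hom_const4: "\<Psi> (const4 c) = const4 c"
  using assms by (auto simp: continuous_hom_def)

lemma continuous_hom_0: "continuous_hom \<Psi> \<Longrightarrow> \<Psi> 0 = 0"
  using continuous_hom_const4[of \<Psi> 0] by (simp add: const4_0)

lemma continuous_hom_diff: "continuous_hom \<Psi> \<Longrightarrow> \<Psi> (F - G) = \<Psi> F - \<Psi> G"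
  using continuous_hom_add[of \<Psi> "F - G" G] by simp

lemma continuous_hom_power:
  assumes "continuous_hom \<Psi>"
  shows "\<Psi> (F ^ n) = \<Psi> F ^ n"
proof -
  have "\<Psi> 1 = 1"
    using continuous_hom_const4[OF assms, of 1] by (simp add: const4_1)
  then show ?thesis
    by (induction n) (simp_all add: continuous_hom_mult[OF assms])
qed

lemma continuous_hom_comp:
  "continuous_hom \<Psi> \<Longrightarrow> continuous_hom \<Phi> \<Longrightarrow> continuous_hom (\<lambda>F. \<Psi> (\<Phi> F))"
  by (simp add: continuous_hom_def)

text \<open>Modulo high degree a locally finite sum is finite, and additivity handles finite sums.
  Only additivity is assumed so that multiplication by a fixed series is covered as well.\<close>

lemma additive_formal_sum:
  assumes add: "\<And>F G. \<Psi> (F + G) = \<Psi> F + \<Psi> G"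
    and van: "\<And>D F. vanish D F \<Longrightarrow> vanish D (\<Psi> F)" and lf: "locally_finite S"
  shows "\<Psi> (formal_sum S) = formal_sum (\<lambda>x. \<Psi> (S x))"
proof (rule fps4_eqI)
  fix a
  interpret additive \<Psi> by standard (rule add)
  define D where "D = Suc (deg4 a)"
  \<comment> \<open>The members of the family that reach degree at most \<open>deg4 a\<close>; all
    others are invisible at \<open>a\<close>, before and after applying
    \<open>\<Psi>\<close>.\<close>
  define X where "X = (\<Union>b\<in>{b. deg4 b < D}. {x. coef (S x) b \<noteq> 0})"
  have finX: "finite X"
    unfolding X_def using lf finite_deg4_less by (auto simp: locally_finite_def)
  have out: "vanish D (S x)" if "x \<notin> X" for x
    using that by (auto simp: X_def vanish_def)
  have "vanish D (formal_sum S - sum S X)"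
    unfolding vanish_def
  proof (intro allI impI)
    fix b assume b: "deg4 b < D"
    have "coef (formal_sum S) b = (\<Sum>x\<in>X. coef (S x) b)"
      unfolding coef_formal_sum
      by (rule Sum_any.expand_superset) (use finX b in \<open>auto simp: X_def\<close>)
    then show "coef (formal_sum S - sum S X) b = 0" by simp
  qed
  then have "vanish D (\<Psi> (formal_sum S) - (\<Sum>x\<in>X. \<Psi> (S x)))"
    using van diff sum by metis
  then have "coef (\<Psi> (formal_sum S)) a = (\<Sum>x\<in>X. coef (\<Psi> (S x)) a)"
    by (auto simp: vanish_def D_def)
  also have "\<dots> = Sum_any (\<lambda>x. coef (\<Psi> (S x)) a)"
  proof (rule Sum_any.expand_superset[symmetric])
    have "coef (\<Psi> (S x)) a = 0" if "x \<notin> X" for x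
      using van[OF out[OF that]] by (simp add: vanish_def D_def)
    then show "{x. coef (\<Psi> (S x)) a \<noteq> 0} \<subseteq> X" by blast
  qed (fact finX)
  finally show "coef (\<Psi> (formal_sum S)) a = coef (formal_sum (\<lambda>x. \<Psi> (S x))) a"
    by (simp add: coef_formal_sum)
qed

lemma continuous_hom_formal_sum:
  assumes "continuous_hom \<Psi>" "locally_finite S"
  shows "\<Psi> (formal_sum S) = formal_sum (\<lambda>x. \<Psi> (S x))"
  using assms by (intro additive_formal_sum) (auto simp: continuous_hom_def)

lemma mult_formal_sum:
  assumes "locally_finite S"
  shows "G * formal_sum S = formal_sum (\<lambda>x. G * S x)"
  using assms by (intro additive_formal_sum) (auto simp: distrib_left intro: vanish_multI2)

section \<open>Substitution of power series for the variables\<close>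

definition mon_at :: "fps4 \<Rightarrow> fps4 \<Rightarrow> fps4 \<Rightarrow> fps4 \<Rightarrow> mon4 \<Rightarrow> fps4"
  where "mon_at A B C D = (\<lambda>(i, j, k, l). A ^ i * B ^ j * C ^ k * D ^ l)"

lemma mon_at_0: "mon_at A B C D (0, 0, 0, 0) = 1"
  by (simp add: mon_at_def)

lemma mon_at_add: "mon_at A B C D (a + b) = mon_at A B C D a * mon_at A B C D b"
  by (cases a; cases b) (simp add: mon_at_def power_add mult_ac)

lemma vanish_mon_at:
  assumes "vanish 1 A" "vanish 1 B" "vanish 1 C" "vanish 1 D"
  shows "vanish (deg4 a) (mon_at A B C D a)"
proof (cases a)
  case (fields i j k l)
  have "vanish (i * 1 + j * 1 + k * 1 + l * 1) (A ^ i * B ^ j * C ^ k * D ^ l)"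
    by (intro vanish_mult vanish_power assms)
  then show ?thesis by (simp add: fields mon_at_def deg4_def)
qed

lemma substitute4_mon_at:
  "substitute4 F A B C D = formal_sum (\<lambda>a. const4 (coef F a) * mon_at A B C D a)"
  unfolding substitute4_def
  by (rule arg_cong[where f = formal_sum]) (auto simp: fun_eq_iff mon_at_def coef_def mult.assoc)

lemma coef_substitute4:
  assumes "vanish 1 A" "vanish 1 B" "vanish 1 C" "vanish 1 D" "deg4 b \<le> N"
  shows "coef (substitute4 F A B C D) b
    = (\<Sum>a | deg4 a \<le> N. coef F a * coef (mon_at A B C D a) b)"
  unfolding substitute4_mon_at coef_formal_sum coef_const4_mult
proof (rule Sum_any.expand_superset)
  have "deg4 a \<le> N" if "coef (mon_at A B C D a) b \<noteq> 0" for a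
    using vanish_mon_at[OF assms(1-4), of a] that assms(5)
    unfolding vanish_def by (meson le_trans not_le)
  then show "{a. coef F a * coef (mon_at A B C D a) b \<noteq> 0} \<subseteq> {a. deg4 a \<le> N}" by auto
qed (rule finite_deg4)

text \<open>The main point is multiplicativity. For a fixed output coefficient only monomials of
  degree at most \<open>N\<close> matter, so both sides reduce to finite sums over pairs of
  monomials.\<close>

lemma continuous_hom_substitute4:
  assumes van: "vanish 1 A" "vanish 1 B" "vanish 1 C" "vanish 1 D"
  shows "continuous_hom (\<lambda>F. substitute4 F A B C D)"
proof -
  let ?S = "\<lambda>F. substitute4 F A B C D" and ?T = "mon_at A B C D"
  note sub = coef_substitute4[OF van]
  have "?S (F + G) = ?S F + ?S G" for F G
    by (rule fps4_eqI) (simp add: sub[OF order_refl] sum.distrib algebra_simps)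
  moreover have "?S (F * G) = ?S F * ?S G" for F G
  proof (rule fps4_eqI)
    fix b
    define N where "N = deg4 b"
    let ?L = "{a. deg4 a \<le> N}"
    have "coef (?S (F * G)) b
        = (\<Sum>a\<in>?L. \<Sum>(c, d) | c + d = a. coef F c * coef G d * coef (?T a) b)"
      by (simp add: sub[of b N] N_def coef_mult_pairs sum_distrib_right split_beta)
    also have "\<dots> = (\<Sum>(a, c, d)\<in>Sigma ?L (\<lambda>a. {(c, d). c + d = a}).
        coef F c * coef G d * coef (?T a) b)"
    proof (subst sum.Sigma)
      show "\<forall>a\<in>?L. finite {(c, d). c + d = a}" using finite_decompositions by blast
    qed (auto simp: finite_deg4 split_beta)
    also have "\<dots> = (\<Sum>(c, d) | deg4 c + deg4 d \<le> N. coef F c * coef G d * coef (?T (c + d)) b)"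
      by (rule sum.reindex_bij_witness[of _ "\<lambda>(c, d). (c + d, c, d)" snd]) (auto simp: deg4_def)
    \<comment> \<open>Enlarging the range to a full square, where the sum factors, adds only pairs
      whose image starts in degree above \<open>N\<close>.\<close>
    also have "\<dots> = (\<Sum>(c, d)\<in>?L \<times> ?L. coef F c * coef G d * coef (?T (c + d)) b)"
    proof (rule sum.mono_neutral_left)
      have *: "coef (?T (c + d)) b = 0" if "\<not> deg4 c + deg4 d \<le> N" for c d
        using vanish_mon_at[OF van, of "c + d"] that by (simp add: vanish_def N_def deg4_add)
      show "\<forall>x\<in>?L \<times> ?L - {(c, d). deg4 c + deg4 d \<le> N}.
          (case x of (c, d) \<Rightarrow> coef F c * coef G d * coef (?T (c + d)) b) = 0"
      proof
        fix x assume "x \<in> ?L \<times> ?L - {(c, d). deg4 c + deg4 d \<le> N}"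
        then show "(case x of (c, d) \<Rightarrow> coef F c * coef G d * coef (?T (c + d)) b) = 0"
          by (cases x) (simp add: *)
      qed
    qed (auto simp: finite_deg4)
    also have "\<dots> = coef ((\<Sum>c\<in>?L. const4 (coef F c) * ?T c) * (\<Sum>d\<in>?L. const4 (coef G d) * ?T d)) b"
    proof -
      have "const4 x * s * (const4 y * t) = const4 x * (const4 y * (s * t))" for x y s t
        by (simp only: mult_ac)
      then show ?thesis
        by (simp only: sum_product sum.cartesian_product mon_at_add case_prod_unfold coef_sum coef_const4_mult mult.assoc)
    qed
    \<comment> \<open>The truncations may be replaced by the full series, since the factors of a
      monomial have no larger degree than the monomial.\<close>
    also have "\<dots> = coef (?S F * ?S G) b"
    proof -
      have tr: "coef (\<Sum>c\<in>?L. const4 (coef H c) * ?T c) b' = coef (?S H) b'"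
        if "deg4 b' \<le> N" for H b'
        using that by (simp add: sub[of b' N])
      show ?thesis
        by (rule coef_mult_cong; rule tr) (metis N_def deg4_le)+
    qed
    finally show "coef (?S (F * G)) b = coef (?S F * ?S G) b" .
  qed
  moreover have "?S (const4 c) = const4 c" for c
  proof (rule fps4_eqI)
    fix b
    have "coef (?S (const4 c)) b = (\<Sum>a\<in>{(0,0,0,0)}. coef (const4 c) a * coef (?T a) b)"
      unfolding sub[OF order_refl]
      by (rule sum.mono_neutral_right) (rule finite_deg4, auto simp: coef_const4 deg4_def)
    then show "coef (?S (const4 c)) b = coef (const4 c) b"
      by (simp add: mon_at_0 coef_const4 coef_one)
  qed
  moreover have "vanish D' (?S F)" if "vanish D' F" for D' F
    unfolding vanish_def
  proof (intro allI impI)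
    fix b assume "deg4 b < D'"
    then show "coef (?S F) b = 0"
      unfolding sub[OF order_refl] using that by (intro sum.neutral) (auto simp: vanish_def)
  qed
  ultimately show ?thesis by (simp add: continuous_hom_def)
qed

lemma coef_mon_at_var:
  "coef (mon_at var_z var_w var_zbar var_wbar a) b = (if a = b then 1 else 0)"
proof (cases a; cases b)
  fix i j k l i' j' k' l' assume ab: "a = (i, j, k, l)" "b = (i', j', k', l')"
  have "mon_at var_z var_w var_zbar var_wbar a
    = fps_X ^ i * fps_const (fps_X ^ j * fps_const (fps_X ^ k * fps_const (fps_X ^ l)))"
    unfolding ab mon_at_def var_z_def var_w_def var_zbar_def var_wbar_def fps_const_power prod.case
      mult.assoc fps_const_mult ..
  then show ?thesis
    by (auto simp: ab coef_def coeff4_def fps_X_power_mult_nth)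
qed

lemma coef_var_power:
  "coef (var_z ^ n) b = (if b = (n, 0, 0, 0) then 1 else 0)"
  "coef (var_w ^ n) b = (if b = (0, n, 0, 0) then 1 else 0)"
  "coef (var_zbar ^ n) b = (if b = (0, 0, n, 0) then 1 else 0)"
  "coef (var_wbar ^ n) b = (if b = (0, 0, 0, n) then 1 else 0)"
  using coef_mon_at_var[of "(n, 0, 0, 0)" b] coef_mon_at_var[of "(0, n, 0, 0)" b]
    coef_mon_at_var[of "(0, 0, n, 0)" b] coef_mon_at_var[of "(0, 0, 0, n)" b]
  by (auto simp: mon_at_def)

lemma vanish_var: "vanish 1 var_z" "vanish 1 var_w" "vanish 1 var_zbar" "vanish 1 var_wbar"
  using coef_var_power[of 1] by (auto simp: vanish_def deg4_def)

lemmas [simp] = vanish_var[unfolded One_nat_def]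

lemma substitute4_var:
  assumes van: "vanish 1 A" "vanish 1 B" "vanish 1 C" "vanish 1 D"
  shows "substitute4 var_z A B C D = A" "substitute4 var_w A B C D = B"
    "substitute4 var_zbar A B C D = C" "substitute4 var_wbar A B C D = D"
proof -
  have *: "substitute4 F A B C D = mon_at A B C D a"
    if "\<And>b. coef F b = (if b = a then 1 else 0)" for F a
  proof -
    have "const4 (coef F b) * mon_at A B C D b = (if b = a then mon_at A B C D a else 0)" for b
      by (simp add: that const4_0 const4_1)
    then show ?thesis
      unfolding substitute4_mon_at
      by (intro fps4_eqI) (simp add: coef_formal_sum if_distrib[of "\<lambda>F. coef F _"] cong: if_cong)
  qed
  show "substitute4 var_z A B C D = A" "substitute4 var_w A B C D = B"
    "substitute4 var_zbar A B C D = C" "substitute4 var_wbar A B C D = D"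
    using *[of var_z "(1, 0, 0, 0)"] *[of var_w "(0, 1, 0, 0)"] *[of var_zbar "(0, 0, 1, 0)"]
      *[of var_wbar "(0, 0, 0, 1)"] coef_var_power[of 1] by (simp_all add: mon_at_def)
qed

section \<open>The pulled-back equation on the complexified hypersurface\<close>

text \<open>The bracket of the admissible form with arbitrary series in place of z, cnj z and u;
  homomorphisms act on it through these three arguments.\<close>

definition form_at :: "real \<Rightarrow> (nat \<Rightarrow> nat \<Rightarrow> complex fps) \<Rightarrow> fps4 \<Rightarrow> fps4 \<Rightarrow> fps4 \<Rightarrow> fps4"
  where "form_at \<epsilon> h A B U = const4 (of_real \<epsilon>) * A * B +
    formal_sum (\<lambda>(k, l). if k \<ge> 2 \<and> l \<ge> 2
      then formal_sum (\<lambda>j. const4 (h k l $ j) * U ^ j) * A ^ k * B ^ l else 0)"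

definition series2 :: "(nat \<Rightarrow> nat \<Rightarrow> complex) \<Rightarrow> fps4 \<Rightarrow> fps4 \<Rightarrow> fps4"
  where "series2 c A B = formal_sum (\<lambda>(i, j). const4 (c i j) * A ^ i * B ^ j)"

lemma vanish_var_u: "vanish 1 var_u"
  unfolding var_u_def by (intro vanish_const4_mult vanish_add vanish_var)

lemma admissible_rhs_eq:
  "admissible_rhs m \<epsilon> h = const4 (1 / 2) * var_u ^ m * form_at \<epsilon> h var_z var_zbar var_u"
  unfolding admissible_rhs_def form_at_def subst_u_def ..

lemma holo_eq: "holo f = series2 (\<lambda>i j. f $ i $ j) var_z var_w"
  and antiholo_eq: "antiholo f = series2 (\<lambda>i j. cnj (f $ i $ j)) var_zbar var_wbar"
  by (simp_all add: holo_def antiholo_def series2_def)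

lemma vanish_monomial2:
  assumes "vanish 1 A" "vanish 1 B"
  shows "vanish (i + j) (const4 c * A ^ i * B ^ j)"
  using vanish_mult[OF vanish_const4_mult[OF vanish_power[OF assms(1), of i]]
      vanish_power[OF assms(2), of j]] by simp

lemma finite_pair_sum_le: "finite {x :: nat \<times> nat. fst x + snd x \<le> n}"
  by (rule finite_subset[of _ "{..n} \<times> {..n}"]) auto

lemma vanish_series2:
  assumes "vanish 1 A" "vanish 1 B" "c 0 0 = 0"
  shows "vanish 1 (series2 c A B)"
  unfolding series2_def
proof (rule vanish_formal_sum)
  fix x :: "nat \<times> nat"
  obtain i j where x: "x = (i, j)" by (cases x)
  show "vanish 1 (case x of (i, j) \<Rightarrow> const4 (c i j) * A ^ i * B ^ j)"
  proof (cases "i + j = 0")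
    case True
    then show ?thesis using assms(3) by (simp add: x const4_0 vanish_def)
  next
    case False
    then have "1 \<le> i + j" by linarith
    from vanish_mono[OF vanish_monomial2[OF assms(1,2)] this] show ?thesis by (simp add: x)
  qed
qed

lemma continuous_hom_series2:
  assumes hom: "continuous_hom \<Psi>" and van: "vanish 1 A" "vanish 1 B"
  shows "\<Psi> (series2 c A B) = series2 c (\<Psi> A) (\<Psi> B)"
proof -
  have "locally_finite (\<lambda>(i, j). const4 (c i j) * A ^ i * B ^ j)"
    by (rule locally_finiteI[where d = "\<lambda>x. fst x + snd x"])
      (auto simp: split_beta finite_pair_sum_le intro: vanish_monomial2[OF van])
  then show ?thesis
    unfolding series2_def continuous_hom_formal_sum[OF hom]
    by (simp add: case_prod_unfold continuous_hom_mult[OF hom] continuous_hom_const4[OF hom]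
        continuous_hom_power[OF hom] continuous_hom_formal_sum[OF hom])
qed

lemma locally_finite_form:
  assumes "vanish 1 A" "vanish 1 B"
  shows "locally_finite (\<lambda>(k, l). if k \<ge> 2 \<and> l \<ge> (2 :: nat) then F k l * A ^ k * B ^ l else 0)"
proof (rule locally_finiteI[where d = "\<lambda>x. fst x + snd x"])
  have "vanish (k + l) (F k l * A ^ k * B ^ l)" for k l
    using vanish_mult[OF vanish_multI2[OF vanish_power[OF assms(1), of k], of "F k l"]
        vanish_power[OF assms(2), of l]] by simp
  then show "vanish (fst x + snd x)
      (case x of (k, l) \<Rightarrow> if k \<ge> 2 \<and> l \<ge> 2 then F k l * A ^ k * B ^ l else 0)" for x
    by (auto simp: split_beta vanish_def)
qed (rule finite_pair_sum_le)

lemma continuous_hom_form_at: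
  assumes hom: "continuous_hom \<Psi>" and van: "vanish 1 A" "vanish 1 B" "vanish 1 U"
  shows "\<Psi> (form_at \<epsilon> h A B U) = form_at \<epsilon> h (\<Psi> A) (\<Psi> B) (\<Psi> U)"
proof -
  have 1: "\<Psi> (formal_sum (\<lambda>j. const4 (c j) * U ^ j)) = formal_sum (\<lambda>j. const4 (c j) * \<Psi> U ^ j)" for c
  proof -
    have "locally_finite (\<lambda>j. const4 (c j) * U ^ j)"
    proof (rule locally_finiteI[where d = "\<lambda>j. j"])
      show "vanish j (const4 (c j) * U ^ j)" for j
        using vanish_power[OF van(3), of j] by (simp add: vanish_const4_mult)
    qed simp
    then show ?thesis
      by (simp add: continuous_hom_formal_sum[OF hom] continuous_hom_mult[OF hom]
          continuous_hom_const4[OF hom] continuous_hom_power[OF hom])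
  qed
  from locally_finite_form[OF van(1,2), of "\<lambda>k l. formal_sum (\<lambda>j. const4 (h k l $ j) * U ^ j)"]
  show ?thesis
    unfolding form_at_def continuous_hom_add[OF hom] continuous_hom_formal_sum[OF hom]
    by (simp add: case_prod_unfold continuous_hom_mult[OF hom] continuous_hom_const4[OF hom] 1
        continuous_hom_power[OF hom] continuous_hom_formal_sum[OF hom] if_distrib[of \<Psi>]
        continuous_hom_0[OF hom] cong: if_cong)
qed

lemma const4_mult: "const4 a * const4 b = const4 (a * b)"
  by (simp add: const4_def)

text \<open>The real coordinate on the hypersurface is \<open>u\<close>, represented by the variable \<^const>\<open>var_w\<close>;
  on it \<open>w\<close> and \<open>cnj w\<close> are the series \<open>u \<plusminus> (\<i>/2) u^m R\<close>.\<close>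

lemma transforms_identity:
  fixes f g :: fps2
  assumes tr: "transforms (f, g) (defining_function m \<epsilon> h) (defining_function m \<epsilon>' h')"
    and f0: "f $ 0 $ 0 = 0" and g0: "g $ 0 $ 0 = 0" and m: "m \<ge> 1"
  defines "\<delta> \<equiv> const4 (\<i> / 2) * (var_w ^ m * form_at \<epsilon> h var_z var_zbar var_w)"
  defines "f1 \<equiv> series2 (\<lambda>i j. f $ i $ j) var_z (var_w + \<delta>)"
    and "f2 \<equiv> series2 (\<lambda>i j. cnj (f $ i $ j)) var_zbar (var_w - \<delta>)"
    and "g1 \<equiv> series2 (\<lambda>i j. g $ i $ j) var_z (var_w + \<delta>)"
    and "g2 \<equiv> series2 (\<lambda>i j. cnj (g $ i $ j)) var_zbar (var_w - \<delta>)"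
  defines "\<gamma> \<equiv> const4 (1 / 2) * (g1 + g2)"
  shows "g1 - g2 = const4 \<i> * (\<gamma> ^ m * form_at \<epsilon>' h' f1 f2 \<gamma>)"
proof -
  have vd: "vanish 1 \<delta>"
    unfolding \<delta>_def using m vanish_mono[OF vanish_power[OF vanish_var(2), of m]]
    by (intro vanish_const4_mult vanish_multI1) simp
  have v: "vanish 1 (var_w + \<delta>)" "vanish 1 (var_w - \<delta>)"
    using vd by (auto intro: vanish_add vanish_diff)
  \<comment> \<open>Restriction to the complexified hypersurface.\<close>
  define \<Psi> where "\<Psi> = (\<lambda>F. substitute4 F var_z (var_w + \<delta>) var_zbar (var_w - \<delta>))"
  have hom: "continuous_hom \<Psi>"
    unfolding \<Psi>_def by (intro continuous_hom_substitute4 vanish_var v)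
  note hs = continuous_hom_mult[OF hom] continuous_hom_const4[OF hom] continuous_hom_add[OF hom]
    continuous_hom_diff[OF hom] continuous_hom_power[OF hom]
  have vars: "\<Psi> var_z = var_z" "\<Psi> var_w = var_w + \<delta>" "\<Psi> var_zbar = var_zbar"
    "\<Psi> var_wbar = var_w - \<delta>"
    unfolding \<Psi>_def by (intro substitute4_var vanish_var v)+
  have u: "\<Psi> var_u = var_w"
    unfolding var_u_def hs vars by (rule fps4_eqI) simp
  have double: "var_w + \<delta> - (var_w - \<delta>) = const4 2 * \<delta>"
    by (rule fps4_eqI) simp
  \<comment> \<open>On the parametrised hypersurface v is \<open>\<delta> / \<i>\<close>, which is
    half of u^m R. So the defining function restricts to zero, and the unknown factor
    \<open>a\<close> disappears with it.\<close>
  have "\<Psi> (defining_function m \<epsilon> h) = 0"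
    unfolding defining_function_def admissible_rhs_eq var_v_def hs vars u
      continuous_hom_form_at[OF hom vanish_var(1) vanish_var(3) vanish_var_u]
      double by (simp add: \<delta>_def mult.assoc[symmetric] const4_mult)
  moreover obtain a where "substitute4 (defining_function m \<epsilon>' h') (holo f) (holo g) (antiholo f)
      (antiholo g) = a * defining_function m \<epsilon> h"
    using tr by (auto simp: transforms_def)
  ultimately have 0: "\<Psi> (substitute4 (defining_function m \<epsilon>' h') (holo f) (holo g) (antiholo f)
      (antiholo g)) = 0"
    by (simp add: hs)
  have van: "vanish 1 (holo f)" "vanish 1 (holo g)" "vanish 1 (antiholo f)" "vanish 1 (antiholo g)"
    unfolding holo_eq antiholo_eq by (intro vanish_series2 vanish_var; simp add: f0 g0)+
  \<comment> \<open>Pulling back by the map and then restricting sends the four target variables to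
    \<open>f1\<close>, \<open>g1\<close>, \<open>f2\<close>, \<open>g2\<close>.\<close>
  define \<Phi> where "\<Phi> = (\<lambda>F. \<Psi> (substitute4 F (holo f) (holo g) (antiholo f) (antiholo g)))"
  have hom': "continuous_hom \<Phi>"
    unfolding \<Phi>_def using continuous_hom_comp[OF hom continuous_hom_substitute4[OF van]] .
  note hs' = continuous_hom_mult[OF hom'] continuous_hom_const4[OF hom'] continuous_hom_add[OF hom']
    continuous_hom_diff[OF hom'] continuous_hom_power[OF hom']
  have vars': "\<Phi> var_z = f1" "\<Phi> var_w = g1" "\<Phi> var_zbar = f2" "\<Phi> var_wbar = g2"
    unfolding \<Phi>_def substitute4_var[OF van] f1_def f2_def g1_def g2_def
    by (simp_all add: holo_eq antiholo_eq continuous_hom_series2[OF hom] vars)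
  have u': "\<Phi> var_u = \<gamma>"
    unfolding var_u_def hs' vars' \<gamma>_def ..
  have "\<Phi> (defining_function m \<epsilon>' h')
      = const4 (1 / (2 * \<i>)) * (g1 - g2) - const4 (1 / 2) * \<gamma> ^ m * form_at \<epsilon>' h' f1 f2 \<gamma>"
    unfolding defining_function_def admissible_rhs_eq var_v_def hs' vars' u'
      continuous_hom_form_at[OF hom' vanish_var(1) vanish_var(3) vanish_var_u] ..
  with 0 have "const4 (1 / (2 * \<i>)) * (g1 - g2) = const4 (1 / 2) * (\<gamma> ^ m * form_at \<epsilon>' h' f1 f2 \<gamma>)"
    by (simp add: \<Phi>_def mult.assoc)
  then have "const4 (2 * \<i>) * (const4 (1 / (2 * \<i>)) * (g1 - g2))
      = const4 (2 * \<i>) * (const4 (1 / 2) * (\<gamma> ^ m * form_at \<epsilon>' h' f1 f2 \<gamma>))"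
    by (rule arg_cong)
  then show ?thesis
    by (simp add: mult.assoc[symmetric] const4_mult const4_1)
qed

text \<open>The coefficient of \<open>z^k cnj z^l u^n\<close>; series in these three variables are elements of
  \<^typ>\<open>fps4\<close> whose last variable is ignored.\<close>

definition cf :: "fps4 \<Rightarrow> nat \<Rightarrow> nat \<Rightarrow> nat \<Rightarrow> complex"
  where "cf F k l n = coef F (k, n, l, 0)"

lemma cf_form_at:
  "cf (form_at \<epsilon> h var_z var_zbar var_w) k l n =
    (if k = 1 \<and> l = 1 \<and> n = 0 then of_real \<epsilon> else 0) +
    (if k \<ge> 2 \<and> l \<ge> 2 then h k l $ n else 0)"
proof -
  have mon: "coef (var_z ^ k * var_zbar ^ l) a = (if a = (k, 0, l, 0) then 1 else 0)" for k l a
    using coef_mon_at_var[of "(k, 0, l, 0)" a] by (auto simp: mon_at_def mult_ac)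
  have U: "coef (formal_sum (\<lambda>j. const4 (c j) * var_w ^ j)) a =
     (case a of (i, j, k, l) \<Rightarrow> if i = 0 \<and> k = 0 \<and> l = 0 then c j else 0)" for c a
    by (auto simp: coef_formal_sum coef_var_power if_distrib[of "(*) _"] cong: if_cong split: prod.splits)
  have prod: "coef (formal_sum (\<lambda>j. const4 (c j) * var_w ^ j) * var_z ^ k * var_zbar ^ l) a =
     (case a of (i, j, k', l') \<Rightarrow> if i = k \<and> k' = l \<and> l' = 0 then c j else 0)"
    (is "coef (?U * _ * _) a = _") for c k l a
  proof (cases a)
    case (fields i j k' l')
    show ?thesis
    proof (cases "i = k \<and> k' = l \<and> l' = 0")
      case True
      have "coef (?U * (var_z ^ k * var_zbar ^ l)) ((0, j, 0, 0) + (k, 0, l, 0))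
        = coef ?U (0, j, 0, 0) * coef (var_z ^ k * var_zbar ^ l) (k, 0, l, 0)"
        by (rule coef_mult_unique) (auto simp: U mon split: prod.splits if_splits)
      then show ?thesis using True by (simp add: fields U mon mult.assoc)
    next
      case False
      have "coef (?U * (var_z ^ k * var_zbar ^ l)) a = 0"
        by (rule ccontr, erule coef_mult_nonzero)
          (use False in \<open>auto simp: U mon fields split: prod.splits if_splits\<close>)
      then show ?thesis by (simp only: fields prod.case mult.assoc False if_False)
    qed
  qed
  have 1: "coef (const4 c * var_z * var_zbar) (k, n, l, 0) = (if k = 1 \<and> l = 1 \<and> n = 0 then c else 0)" for c
    using mon[of 1 1 "(k, n, l, 0)"] by (simp add: mult.assoc)
  have 2: "(\<lambda>x. coef (case x of (k, l) \<Rightarrow> if 2 \<le> k \<and> 2 \<le> l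
      then formal_sum (\<lambda>j. const4 (h k l $ j) * var_w ^ j) * var_z ^ k * var_zbar ^ l else 0) (k, n, l, 0))
    = (\<lambda>x. if x = (k, l) then if 2 \<le> k \<and> 2 \<le> l then h k l $ n else 0 else 0)"
    by (auto simp: fun_eq_iff prod split: if_splits)
  show ?thesis
    unfolding cf_def form_at_def coef_add 1 coef_formal_sum 2 by simp
qed

text \<open>Setting w = cnj w = u turns the right-hand side into half of u^m R, whose coefficients
  are visible, and the reality condition into Hermitian symmetry in z and cnj z.\<close>

lemma real_series_coeffs:
  assumes real: "real_series (admissible_rhs m \<epsilon> h)" and kl: "k \<ge> 2" "l \<ge> 2"
  shows "h l k $ n = cnj (h k l $ n)"
proof -
  define F where "F = admissible_rhs m \<epsilon> h"
  define \<Psi> where "\<Psi> = (\<lambda>F. substitute4 F var_z var_w var_zbar var_w)"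
  have hom: "continuous_hom \<Psi>"
    unfolding \<Psi>_def by (intro continuous_hom_substitute4 vanish_var)
  note hs = continuous_hom_mult[OF hom] continuous_hom_const4[OF hom] continuous_hom_add[OF hom]
    continuous_hom_diff[OF hom] continuous_hom_power[OF hom]
  have vars: "\<Psi> var_z = var_z" "\<Psi> var_w = var_w" "\<Psi> var_zbar = var_zbar" "\<Psi> var_wbar = var_w"
    unfolding \<Psi>_def by (intro substitute4_var vanish_var)+
  have u: "\<Psi> var_u = var_w"
    unfolding var_u_def hs vars by (rule fps4_eqI) simp
  have eq: "\<Psi> F = const4 (1 / 2) * (var_w ^ m * form_at \<epsilon> h var_z var_zbar var_w)"
    unfolding F_def admissible_rhs_eq hs vars u
      continuous_hom_form_at[OF hom vanish_var(1) vanish_var(3) vanish_var_u] by (simp add: mult.assoc)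
  have wm: "coef (var_w ^ m * G) ((0, m, 0, 0) + a) = coef G a" for G a
  proof -
    have "coef (var_w ^ m * G) ((0, m, 0, 0) + a) = coef (var_w ^ m) (0, m, 0, 0) * coef G a"
      by (rule coef_mult_unique) (auto simp: coef_var_power split: if_splits)
    then show ?thesis by (simp add: coef_var_power)
  qed
  have 1: "cf (\<Psi> F) k l (m + n) = h k l $ n / 2" if "k \<ge> 2" "l \<ge> 2" for k l
    using cf_form_at[of \<epsilon> h k l n] wm[of _ "(k, n, l, 0)"] that by (simp add: eq cf_def)
  \<comment> \<open>Under this specialisation u^N collects every product of w^j with the power N-j
    of cnj w.\<close>
  have 2: "cf (\<Psi> G) k l N = (\<Sum>j\<in>{0..N}. coeff4 G k j l (N - j))" for G k l N
  proof -
    have mon: "coef (mon_at var_z var_w var_zbar var_w a) b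
       = (case a of (i, j, k', l') \<Rightarrow> if b = (i, j + l', k', 0) then 1 else 0)" for a b
      using coef_mon_at_var[of "case a of (i, j, k', l') \<Rightarrow> (i, j + l', k', 0)" b]
      by (auto simp: mon_at_def power_add mult_ac split: prod.splits if_splits)
    have "cf (\<Psi> G) k l N = (\<Sum>a\<in>(\<lambda>j. (k, j, l, N - j)) ` {0..N}. coef G a)"
      unfolding cf_def \<Psi>_def
        coef_substitute4[OF vanish_var(1,2,3,2) order_refl] mon
    proof (rule sum.mono_neutral_cong_right[OF finite_deg4])
      let ?I = "(\<lambda>j. (k, j, l, N - j)) ` {0..N}"
      show "?I \<subseteq> {a. deg4 a \<le> deg4 (k, N, l, 0)}" by (auto simp: deg4_def)
      have "a \<in> ?I" if "(k, N, l, 0) = (i, j + l', k', 0)" "a = (i, j, k', l')" for a i j k' l'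
        by (rule image_eqI[of _ _ j]) (use that in auto)
      then show "\<forall>a\<in>{a. deg4 a \<le> deg4 (k, N, l, 0)} - ?I.
          coef G a * (case a of (i, j, k', l') \<Rightarrow> if (k, N, l, 0) = (i, j + l', k', 0) then 1 else 0) = 0"
        by (auto split: if_splits)
    qed auto
    also have "\<dots> = (\<Sum>j\<in>{0..N}. coeff4 G k j l (N - j))"
      by (subst sum.reindex) (auto simp: inj_on_def coef_def)
    finally show ?thesis .
  qed
  have "cf (\<Psi> F) l k (m + n) = (\<Sum>j\<in>{0..m + n}. cnj (coeff4 F k (m + n - j) l j))"
    unfolding 2
  proof (rule sum.cong[OF refl])
    show "coeff4 F l j k (m + n - j) = cnj (coeff4 F k (m + n - j) l j)" for j
      using real unfolding real_series_def F_def by blast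
  qed
  \<comment> \<open>Conjugation has exchanged the exponents of w and cnj w; reversing the summation
    index restores the original sum.\<close>
  also have "\<dots> = cnj (cf (\<Psi> F) k l (m + n))"
    unfolding 2 cnj_sum
    by (rule sum.reindex_bij_witness[of _ "\<lambda>j. m + n - j" "\<lambda>j. m + n - j"]) auto
  finally show ?thesis using 1 kl by simp
qed

subsection \<open>Supports\<close>

text \<open>Supports are predicates on exponents, so that products are controlled by adding
  exponents and the estimates reduce to linear arithmetic.\<close>

definition supp :: "fps4 \<Rightarrow> (nat \<Rightarrow> nat \<Rightarrow> nat \<Rightarrow> bool) \<Rightarrow> bool"
  where "supp F P \<longleftrightarrow> (\<forall>k l n. cf F k l n \<noteq> 0 \<longrightarrow> P k l n)"

lemma cf_0 [simp]: "cf 0 k l n = 0"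
  and cf_add [simp]: "cf (F + G) k l n = cf F k l n + cf G k l n"
  and cf_diff [simp]: "cf (F - G) k l n = cf F k l n - cf G k l n"
  and cf_const4_mult [simp]: "cf (const4 c * F) k l n = c * cf F k l n"
  and cf_1: "cf 1 k l n = (if k = 0 \<and> l = 0 \<and> n = 0 then 1 else 0)"
  and cf_formal_sum: "cf (formal_sum S) k l n = Sum_any (\<lambda>x. cf (S x) k l n)"
  and cf_z: "cf (var_z ^ i) k l n = (if k = i \<and> l = 0 \<and> n = 0 then 1 else 0)"
  and cf_zbar: "cf (var_zbar ^ i) k l n = (if k = 0 \<and> l = i \<and> n = 0 then 1 else 0)"
  and cf_w: "cf (var_w ^ i) k l n = (if k = 0 \<and> l = 0 \<and> n = i then 1 else 0)"
  by (auto simp: cf_def coef_one coef_formal_sum coef_var_power)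

lemma cf_formal_sum_single:
  assumes "\<And>x. x \<noteq> x0 \<Longrightarrow> cf (S x) k l n = 0"
  shows "cf (formal_sum S) k l n = cf (S x0) k l n"
proof -
  have "(\<lambda>x. cf (S x) k l n) = (\<lambda>x. if x = x0 then cf (S x0) k l n else 0)"
    using assms by auto
  then show ?thesis by (simp only: cf_formal_sum) simp
qed

lemma supp_mono: "supp F P \<Longrightarrow> (\<And>k l n. P k l n \<Longrightarrow> Q k l n) \<Longrightarrow> supp F Q"
  and supp_0: "supp 0 P"
  and supp_const4_mult: "supp F P \<Longrightarrow> supp (const4 c * F) P"
  and suppD: "supp F P \<Longrightarrow> cf F k l n \<noteq> 0 \<Longrightarrow> P k l n"
  and supp_cf_0: "supp F P \<Longrightarrow> \<not> P k l n \<Longrightarrow> cf F k l n = 0"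
  by (auto simp: supp_def)

lemma supp_add: "supp F P \<Longrightarrow> supp G P \<Longrightarrow> supp (F + G) P"
  unfolding supp_def by (metis cf_add add.right_neutral)

lemma supp_formal_sum:
  assumes "\<And>x. supp (S x) P"
  shows "supp (formal_sum S) P"
  unfolding supp_def
proof (intro allI impI, rule ccontr)
  fix k l n assume nz: "cf (formal_sum S) k l n \<noteq> 0" and "\<not> P k l n"
  then have "(\<lambda>x. cf (S x) k l n) = (\<lambda>x. 0)"
    using assms by (auto simp: supp_def fun_eq_iff)
  then show False using nz by (simp only: cf_formal_sum) simp
qed

lemma cf_mult_nonzero:
  assumes "cf (F * G) k l n \<noteq> 0"
  obtains k1 l1 n1 k2 l2 n2 where "k = k1 + k2" "l = l1 + l2" "n = n1 + n2"
    "cf F k1 l1 n1 \<noteq> 0" "cf G k2 l2 n2 \<noteq> 0"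
proof -
  obtain b c where bc: "(k, n, l, 0) = b + c" "coef F b \<noteq> 0" "coef G c \<noteq> 0"
    using assms unfolding cf_def by (rule coef_mult_nonzero)
  obtain k1 n1 l1 j1 k2 n2 l2 j2 where "b = (k1, n1, l1, j1)" "c = (k2, n2, l2, j2)"
    by (metis prod_cases4)
  with bc show thesis
    by (intro that[of k1 k2 l1 l2 n1 n2]) (auto simp: cf_def)
qed

lemma cf_mult_unique:
  assumes "\<And>k l n k' l' n'. k + k' = k1 + k2 \<Longrightarrow> l + l' = l1 + l2 \<Longrightarrow> n + n' = n1 + n2 \<Longrightarrow>
    cf F k l n \<noteq> 0 \<Longrightarrow> cf G k' l' n' \<noteq> 0 \<Longrightarrow> k = k1 \<and> l = l1 \<and> n = n1"
  shows "cf (F * G) (k1 + k2) (l1 + l2) (n1 + n2) = cf F k1 l1 n1 * cf G k2 l2 n2"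
proof -
  have "coef (F * G) ((k1, n1, l1, 0) + (k2, n2, l2, 0)) = coef F (k1, n1, l1, 0) * coef G (k2, n2, l2, 0)"
  proof (rule coef_mult_unique)
    fix b c assume bc: "b + c = (k1, n1, l1, 0) + (k2, n2, l2, 0)" "coef F b \<noteq> 0" "coef G c \<noteq> 0"
    obtain k n l j k' n' l' j' where e: "b = (k, n, l, j)" "c = (k', n', l', j')"
      by (metis prod_cases4)
    show "b = (k1, n1, l1, 0) \<and> c = (k2, n2, l2, 0)"
      using bc assms[of k k' l l' n n'] by (auto simp: e cf_def)
  qed
  then show ?thesis by (simp add: cf_def)
qed

lemma supp_mult:
  assumes "supp F P" "supp G Q"
    and "\<And>k l n k' l' n'. P k l n \<Longrightarrow> Q k' l' n' \<Longrightarrow> S (k + k') (l + l') (n + n')"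
  shows "supp (F * G) S"
  unfolding supp_def
proof (intro allI impI)
  fix k l n assume "cf (F * G) k l n \<noteq> 0"
  then show "S k l n"
    by (rule cf_mult_nonzero) (use assms in \<open>auto simp: supp_def\<close>)
qed

lemma supp_var_power:
  "supp (var_z ^ i) (\<lambda>k l n. k = i \<and> l = 0 \<and> n = 0)"
  "supp (var_zbar ^ i) (\<lambda>k l n. k = 0 \<and> l = i \<and> n = 0)"
  "supp (var_w ^ i) (\<lambda>k l n. k = 0 \<and> l = 0 \<and> n = i)"
  "supp 1 (\<lambda>k l n. k = 0 \<and> l = 0 \<and> n = 0)"
  by (auto simp: supp_def cf_z cf_zbar cf_w cf_1)

lemma cf_w_power_mult: "cf (var_w ^ m * F) k l (m + n) = cf F k l n"
  using cf_mult_unique[of 0 k 0 l m n "var_w ^ m" F] by (simp add: cf_w split: if_splits)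

lemma supp_power_ge:
  assumes "supp F (\<lambda>k l n. a * k + b * l + c * n \<ge> d)"
  shows "supp (F ^ s) (\<lambda>k l n. a * k + b * l + c * n \<ge> s * (d :: nat))"
proof (induction s)
  case (Suc s)
  show ?case
    unfolding power_Suc by (rule supp_mult[OF assms Suc]) (simp add: algebra_simps)
qed (simp add: supp_def)

text \<open>The ideal spanned by the
  monomials satisfying \<open>deep m 0\<close> is stable under the substitutions \<open>z \<mapsto> f\<close>, \<open>cnj z \<mapsto> cnj f\<close>,
  \<open>u \<mapsto> Re g\<close>; together with \<open>u^n z^2 (cnj z)^2\<close> for \<open>n \<ge> m - 1\<close> its monomials are exactly those
  permitted in a Fuchsian hypersurface.  The argument \<open>s\<close> multiplies the ideal by \<open>u^s\<close>.\<close>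

definition deep :: "nat \<Rightarrow> nat \<Rightarrow> nat \<Rightarrow> nat \<Rightarrow> nat \<Rightarrow> bool"
  where "deep m s k l n \<longleftrightarrow> n + 2 \<ge> 2 * m + s \<or> n + k \<ge> 2 * m + 2 + s \<or> n + l \<ge> 2 * m + 2 + s \<or>
    n + k + l \<ge> 2 * m + 5 + s"

text \<open>The monomials that do not influence the coefficients of weight \<open>e\<close>, where \<open>z\<close> and \<open>cnj z\<close>
  have weight \<open>1\<close> and \<open>u\<close> has weight \<open>2\<close>.\<close>

definition negl :: "nat \<Rightarrow> nat \<Rightarrow> nat \<Rightarrow> nat \<Rightarrow> nat \<Rightarrow> nat \<Rightarrow> bool"
  where "negl m e s k l n \<longleftrightarrow> deep m s k l n \<or> k + l + n + n > e + s + s"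

text \<open>Sums replace the truncated subtractions of \<open>fuchsian_type\<close>. The z^2 cnj z^2
  exception is not covered by the stability of the ideal and gets its own argument in
  \<open>supp_gamma_ffff\<close>.\<close>

definition permitted :: "nat \<Rightarrow> nat \<Rightarrow> nat \<Rightarrow> nat \<Rightarrow> bool"
  where "permitted m k l n \<longleftrightarrow> deep m 0 k l n \<or> (k = 2 \<and> l = 2 \<and> n + 1 \<ge> m)"

text \<open>The induction statement in the weight. At \<open>e = 0\<close> it is true of every
  hypersurface.\<close>

definition fuchsian_below :: "nat \<Rightarrow> nat \<Rightarrow> (nat \<Rightarrow> nat \<Rightarrow> complex fps) \<Rightarrow> bool"
  where "fuchsian_below e m h \<longleftrightarrow>
    (\<forall>k l n. k \<ge> 2 \<longrightarrow> l \<ge> 2 \<longrightarrow> h k l $ n \<noteq> 0 \<longrightarrow> k + l + n + n \<ge> e \<or> permitted m k l n)"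

text \<open>Contains the exponents of \<open>(u \<plusminus> (\<i>/2) u^m R)^j - u^j\<close> for \<open>j \<ge> 1\<close>.\<close>

definition pert :: "nat \<Rightarrow> nat \<Rightarrow> nat \<Rightarrow> nat \<Rightarrow> nat \<Rightarrow> nat \<Rightarrow> bool"
  where "pert m e j k l n \<longleftrightarrow> n + 1 \<ge> m + j \<and>
    (k = 1 \<and> l = 1 \<or> k \<ge> 2 \<and> l \<ge> 2 \<and>
      (k = 2 \<and> l = 2 \<and> n + 2 \<ge> 2 * m + j \<or> negl m e m k l n \<or>
       j = 1 \<and> k + l + n + n \<ge> e + m + m))"

section \<open>Exponents of powers of the perturbed variable\<close>

lemma deep_mono:
  "deep m s k l n \<Longrightarrow> k \<le> k' \<Longrightarrow> l \<le> l' \<Longrightarrow> n + t \<le> n' \<Longrightarrow> s' \<le> s + t \<Longrightarrow> deep m s' k' l' n'"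
  unfolding deep_def by (elim disjE) auto

lemma negl_mono:
  "negl m e s k l n \<Longrightarrow> k \<le> k' \<Longrightarrow> l \<le> l' \<Longrightarrow> n + t \<le> n' \<Longrightarrow> s' \<le> s + t \<Longrightarrow> negl m e s' k' l' n'"
  unfolding negl_def by (auto elim: deep_mono)

lemma negl_n: "2 * m + s \<le> n + 2 \<Longrightarrow> negl m e s k l n"
  and negl_weight: "e + s + s < k + l + n + n \<Longrightarrow> negl m e s k l n"
  and negl_deep: "deep m s k l n \<Longrightarrow> negl m e s k l n"
  by (simp_all add: deep_def negl_def)

lemma negl_add1: "negl m e s k l n \<Longrightarrow> s' \<le> s + n' \<Longrightarrow> negl m e s' (k + k') (l + l') (n + n')"
  and negl_add2: "negl m e s k l n \<Longrightarrow> s' \<le> s + n' \<Longrightarrow> negl m e s' (k' + k) (l' + l) (n' + n)"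
  by (erule negl_mono; auto)+

lemma negl_shift: "negl m e s k l n \<Longrightarrow> s' \<le> s + n' \<Longrightarrow> negl m e s' k l (n + n')"
  "negl m e s k l n \<Longrightarrow> s' \<le> s + n' \<Longrightarrow> negl m e s' k l (n' + n)"
  "negl m e s k l n \<Longrightarrow> negl m e s k l (Suc n)"
  by (erule negl_mono; auto)+

lemma deep_negl_shift: "deep m 0 k l n \<Longrightarrow> negl m e s k l (s + n)"
  by (rule negl_deep, erule deep_mono[where t = s]) auto

lemmas negl_rules = negl_n negl_weight negl_add1 negl_add2

text \<open>The factor u^m lifts the exception z^2 cnj z^2 u^(m-1) to order 2m-1, the bound of
  \<open>pert\<close> for \<open>j = 1\<close>. Terms of weight at least \<open>e\<close> are not
  yet controlled and form its last alternative.\<close>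

lemma supp_perturbation:
  assumes "fuchsian_below e m h"
  shows "supp (const4 c * (var_w ^ m * form_at \<epsilon> h var_z var_zbar var_w)) (pert m e 1)"
proof -
  have "supp (form_at \<epsilon> h var_z var_zbar var_w)
    (\<lambda>k l n. k = 1 \<and> l = 1 \<and> n = 0 \<or> k \<ge> 2 \<and> l \<ge> 2 \<and> (k + l + n + n \<ge> e \<or> permitted m k l n))"
    using assms by (auto simp: supp_def cf_form_at fuchsian_below_def)
  note supp_form = this
  show ?thesis
    by (rule supp_const4_mult, rule supp_mult[OF supp_var_power(3) supp_form])
      (auto simp: pert_def permitted_def deep_negl_shift)
qed

lemma pert_nonzero: "pert m e j k l n \<Longrightarrow> k \<noteq> 0 \<and> l \<noteq> 0"
  by (auto simp: pert_def)

text \<open>Two factors z cnj z produce z^2 cnj z^2 of order at least 2m+j-1; every other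
  combination of alternatives is negligible.\<close>

lemma pert_mult:
  assumes "pert m e 1 k l n" "pert m e j k' l' n'" "m \<ge> 2" "j \<ge> 1"
  shows "pert m e (Suc j) (k + k') (l + l') (n + n')"
  using assms unfolding pert_def
  apply (elim conjE disjE)
  apply (simp_all add: negl_rules)
  apply (erule negl_mono[where t = 0]; simp)+
  done

text \<open>One more factor u lifts the uncontrolled terms above the weight bound, so they survive
  only for \<open>j = 1\<close>.\<close>

lemma pert_shift:
  "pert m e j k l n \<Longrightarrow> j \<ge> 1 \<Longrightarrow> pert m e (Suc j) (0 + k) (0 + l) (1 + n)"
  "pert m e 1 k l n \<Longrightarrow> j \<ge> 1 \<Longrightarrow> pert m e (Suc j) (k + 0) (l + 0) (n + j)"
  unfolding pert_def
  apply (elim conjE disjE)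
  apply (simp_all add: negl_n negl_weight negl_shift)
  apply (elim conjE disjE)
  apply (simp_all add: negl_n negl_weight negl_shift)
  done

lemma supp_perturbed_power:
  assumes d: "supp \<delta> (pert m e 1)" and m: "m \<ge> 2"
  shows "j \<ge> 1 \<Longrightarrow> supp ((var_w + \<delta>) ^ j - var_w ^ j) (pert m e j)"
proof (induction j rule: nat_induct_at_least)
  case base
  then show ?case using d by simp
next
  case (Suc j)
  \<comment> \<open>Splitting off the pure power lets the correction for \<open>Suc j\<close> arise
    from the one for \<open>j\<close>.\<close>
  have eq: "(var_w + \<delta>) ^ Suc j - var_w ^ Suc j =
      var_w ^ 1 * ((var_w + \<delta>) ^ j - var_w ^ j) + \<delta> * var_w ^ j
      + \<delta> * ((var_w + \<delta>) ^ j - var_w ^ j)"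
    by (simp add: algebra_simps)
  show ?case
    unfolding eq
  proof (intro supp_add)
    show "supp (var_w ^ 1 * ((var_w + \<delta>) ^ j - var_w ^ j)) (pert m e (Suc j))"
      by (rule supp_mult[OF supp_var_power(3) Suc.IH]) (elim conjE, simp only: pert_shift Suc(1))
    show "supp (\<delta> * var_w ^ j) (pert m e (Suc j))"
      by (rule supp_mult[OF d supp_var_power(3)]) (elim conjE, simp only: pert_shift Suc(1))
    show "supp (\<delta> * ((var_w + \<delta>) ^ j - var_w ^ j)) (pert m e (Suc j))"
      by (rule supp_mult[OF d Suc.IH]) (rule pert_mult[OF _ _ m Suc(1)])
  qed
qed

lemma supp_z_mult:
  assumes d: "supp \<delta> (pert m e 1)" and m: "m \<ge> 2"
  shows "supp (var_z ^ i * (var_w + \<delta>) ^ j)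
      (\<lambda>k l n. k = i \<and> l = 0 \<and> n = j \<or> (\<exists>k'. k = i + k' \<and> j \<ge> 1 \<and> pert m e j k' l n))" (is ?z)
    and "supp (var_zbar ^ i * (var_w + \<delta>) ^ j)
      (\<lambda>k l n. k = 0 \<and> l = i \<and> n = j \<or> (\<exists>l'. l = i + l' \<and> j \<ge> 1 \<and> pert m e j k l' n))" (is ?zbar)
proof -
  have "supp ((var_w + \<delta>) ^ j - var_w ^ j) (\<lambda>k l n. j \<ge> 1 \<and> pert m e j k l n)"
    using supp_perturbed_power[OF assms, of j] by (cases j) (simp_all add: supp_def)
  note X = this
  have "supp (var_w ^ j + ((var_w + \<delta>) ^ j - var_w ^ j))
      (\<lambda>k l n. k = 0 \<and> l = 0 \<and> n = j \<or> j \<ge> 1 \<and> pert m e j k l n)"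
    by (rule supp_add; (rule supp_mono[OF supp_var_power(3)] | rule supp_mono[OF X]); simp)
  then have *: "supp ((var_w + \<delta>) ^ j)
      (\<lambda>k l n. k = 0 \<and> l = 0 \<and> n = j \<or> j \<ge> 1 \<and> pert m e j k l n)" by simp
  show ?z by (rule supp_mult[OF supp_var_power(1) *]) simp
  show ?zbar by (rule supp_mult[OF supp_var_power(2) *]) simp
qed

lemma supp_series2:
  assumes "\<And>i j. c i j \<noteq> 0 \<Longrightarrow> supp (A ^ i * B ^ j) P"
  shows "supp (series2 c A B) P"
  unfolding series2_def
proof (rule supp_formal_sum)
  show "supp (case x of (i, j) \<Rightarrow> const4 (c i j) * A ^ i * B ^ j) P" for x
    using assms[of "fst x" "snd x"]
    by (cases "c (fst x) (snd x) = 0")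
      (simp_all add: split_beta const4_0 supp_0 supp_const4_mult mult.assoc)
qed

lemma cf_series2_single:
  assumes "\<And>i j. c i j \<noteq> 0 \<Longrightarrow> cf (A ^ i * B ^ j) k l n \<noteq> 0 \<Longrightarrow> i = i0 \<and> j = j0"
  shows "cf (series2 c A B) k l n = c i0 j0 * cf (A ^ i0 * B ^ j0) k l n"
  unfolding series2_def
  by (subst cf_formal_sum_single[of "(i0, j0)"]) (use assms in \<open>auto simp: mult.assoc split: prod.splits\<close>)

context
  fixes \<delta> m e
  assumes d: "supp \<delta> (pert m e 1)" and m: "m \<ge> 2"
begin

lemma supp_series2_z:
  assumes "\<And>i j. c i j \<noteq> 0 \<Longrightarrow> P i 0 j"
    and "\<And>i j k l n. c i j \<noteq> 0 \<Longrightarrow> j \<ge> 1 \<Longrightarrow> pert m e j k l n \<Longrightarrow> P (i + k) l n"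
  shows "supp (series2 c var_z (var_w + \<delta>)) P"
  by (rule supp_series2, rule supp_mono[OF supp_z_mult(1)[OF d m]], elim disjE exE conjE; hypsubst)
    (erule assms | rule assms; assumption)+

lemma supp_series2_zbar:
  assumes "\<And>i j. c i j \<noteq> 0 \<Longrightarrow> P 0 i j"
    and "\<And>i j k l n. c i j \<noteq> 0 \<Longrightarrow> j \<ge> 1 \<Longrightarrow> pert m e j k l n \<Longrightarrow> P k (i + l) n"
  shows "supp (series2 c var_zbar (var_w + \<delta>)) P"
  by (rule supp_series2, rule supp_mono[OF supp_z_mult(2)[OF d m]], elim disjE exE conjE; hypsubst)
    (erule assms | rule assms; assumption)+

text \<open>The perturbation is divisible by cnj z; setting cnj z = 0 restores w = u and returns the
  coefficients of the original series.\<close>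

lemma cf_series2_z: "cf (series2 c var_z (var_w + \<delta>)) k 0 n = c k n"
proof -
  have s: "supp ((var_w + \<delta>) ^ j - var_w ^ j) (\<lambda>k l n. l \<noteq> 0)" for j
  proof (cases "j = 0")
    case False
    then have "j \<ge> 1" by simp
    show ?thesis
      by (rule supp_mono[OF supp_perturbed_power[OF d m \<open>j \<ge> 1\<close>]],
          drule pert_nonzero, erule conjE, assumption)
  qed (simp add: supp_0)
  have w: "cf ((var_w + \<delta>) ^ j) k 0 n = cf (var_w ^ j) k 0 n" for j k n
    using supp_cf_0[OF s, of 0 j k n] by simp
  have 1: "cf (var_z ^ k * (var_w + \<delta>) ^ n) (k + 0) (0 + 0) (0 + n) = 1"
    by (subst cf_mult_unique) (auto simp: cf_z cf_w w split: if_splits)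
  have "cf (series2 c var_z (var_w + \<delta>)) k 0 n = c k n * cf (var_z ^ k * (var_w + \<delta>) ^ n) k 0 n"
  proof (rule cf_series2_single)
    show "i = k \<and> j = n" if "cf (var_z ^ i * (var_w + \<delta>) ^ j) k 0 n \<noteq> 0" for i j
      using suppD[OF supp_z_mult(1)[OF d m] that] by (auto dest: pert_nonzero)
  qed
  then show ?thesis using 1 by simp
qed

text \<open>The mirror image: the perturbation is also divisible by z.\<close>

lemma cf_series2_zbar: "cf (series2 c var_zbar (var_w + \<delta>)) 0 l n = c l n"
proof -
  have s: "supp ((var_w + \<delta>) ^ j - var_w ^ j) (\<lambda>k l n. k \<noteq> 0)" for j
  proof (cases "j = 0")
    case False
    then have "j \<ge> 1" by simp
    show ?thesis
      by (rule supp_mono[OF supp_perturbed_power[OF d m \<open>j \<ge> 1\<close>]],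
          drule pert_nonzero, erule conjE, assumption)
  qed (simp add: supp_0)
  have w: "cf ((var_w + \<delta>) ^ j) 0 l n = cf (var_w ^ j) 0 l n" for j l n
    using supp_cf_0[OF s, of 0 j l n] by simp
  have 1: "cf (var_zbar ^ l * (var_w + \<delta>) ^ n) (0 + 0) (l + 0) (0 + n) = 1"
    by (subst cf_mult_unique) (auto simp: cf_zbar cf_w w split: if_splits)
  have "cf (series2 c var_zbar (var_w + \<delta>)) 0 l n = c l n * cf (var_zbar ^ l * (var_w + \<delta>) ^ n) 0 l n"
  proof (rule cf_series2_single)
    show "i = l \<and> j = n" if "cf (var_zbar ^ i * (var_w + \<delta>) ^ j) 0 l n \<noteq> 0" for i j
      using suppD[OF supp_z_mult(2)[OF d m] that] by (auto dest: pert_nonzero)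
  qed
  then show ?thesis using 1 by simp
qed

end

section \<open>Terms of the admissible equation after substitution\<close>

text \<open>Distributing the prefactor allows supports and coefficients to be examined one monomial
  of \<open>h\<close> at a time.\<close>

lemma mult_form_at:
  assumes van: "vanish 1 A" "vanish 1 B" "vanish 1 U"
  shows "G * form_at \<epsilon> h A B U = const4 (of_real \<epsilon>) * (G * (A * B)) +
    formal_sum (\<lambda>(k, l). if k \<ge> 2 \<and> l \<ge> 2
      then formal_sum (\<lambda>n. const4 (h k l $ n) * (G * U ^ n * A ^ k * B ^ l)) else 0)"
proof -
  have 1: "locally_finite (\<lambda>j. const4 (c j) * U ^ j)" for c
  proof (rule locally_finiteI[where d = "\<lambda>j. j"])
    show "vanish j (const4 (c j) * U ^ j)" for j
      using vanish_power[OF van(3), of j] by (simp add: vanish_const4_mult)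
  qed simp
  have 2: "locally_finite (\<lambda>(k, l). if k \<ge> 2 \<and> l \<ge> 2
      then formal_sum (\<lambda>j. const4 (h k l $ j) * U ^ j) * A ^ k * B ^ l else 0)"
    by (rule locally_finite_form[OF van(1,2)])
  have 3: "G * (formal_sum (\<lambda>j. const4 (c j) * U ^ j) * A ^ k * B ^ l)
      = formal_sum (\<lambda>n. const4 (c n) * (G * U ^ n * A ^ k * B ^ l))" for c k l
    using mult_formal_sum[OF 1, of "G * A ^ k * B ^ l" c] by (simp add: mult_ac)
  have 4: "G * (case x of (k, l) \<Rightarrow> if k \<ge> 2 \<and> l \<ge> 2
      then formal_sum (\<lambda>j. const4 (h k l $ j) * U ^ j) * A ^ k * B ^ l else 0)
    = (case x of (k, l) \<Rightarrow> if k \<ge> 2 \<and> l \<ge> 2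
      then formal_sum (\<lambda>n. const4 (h k l $ n) * (G * U ^ n * A ^ k * B ^ l)) else 0)" for x
    by (simp add: split_beta 3)
  have 5: "G * (const4 c * A * B) = const4 c * (G * (A * B))" for c
    by (simp only: mult_ac)
  show ?thesis
    unfolding form_at_def distrib_left mult_formal_sum[OF 2] 4 5 ..
qed

lemma supp_mult_form_at:
  assumes van: "vanish 1 A" "vanish 1 B" "vanish 1 U" and AB: "supp (G * (A * B)) P"
    and h: "\<And>k l n. k \<ge> 2 \<Longrightarrow> l \<ge> 2 \<Longrightarrow> h k l $ n \<noteq> 0 \<Longrightarrow> supp (G * U ^ n * A ^ k * B ^ l) P"
  shows "supp (G * form_at \<epsilon> h A B U) P"
  unfolding mult_form_at[OF van]
proof (intro supp_add supp_const4_mult[OF AB] supp_formal_sum)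
  have "supp (const4 (h k l $ n) * (G * U ^ n * A ^ k * B ^ l)) P" if "k \<ge> 2" "l \<ge> 2" for k l n
    using h[OF that, of n] by (cases "h k l $ n = 0") (simp_all add: const4_0 supp_0 supp_const4_mult)
  then show "supp (case x of (k, l) \<Rightarrow> if k \<ge> 2 \<and> l \<ge> 2
      then formal_sum (\<lambda>n. const4 (h k l $ n) * (G * U ^ n * A ^ k * B ^ l)) else 0) P" for x
    by (auto simp: split_beta supp_0 intro: supp_formal_sum)
qed

lemma cf_mult_form_at:
  assumes van: "vanish 1 A" "vanish 1 B" "vanish 1 U" and k0: "k0 \<ge> 2" "l0 \<ge> 2"
    and h: "\<And>k l n. k \<ge> 2 \<Longrightarrow> l \<ge> 2 \<Longrightarrow> h k l $ n \<noteq> 0 \<Longrightarrow> cf (G * U ^ n * A ^ k * B ^ l) K L N \<noteq> 0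
      \<Longrightarrow> k = k0 \<and> l = l0 \<and> n = n0"
  shows "cf (G * form_at \<epsilon> h A B U) K L N = of_real \<epsilon> * cf (G * (A * B)) K L N +
    h k0 l0 $ n0 * cf (G * U ^ n0 * A ^ k0 * B ^ l0) K L N"
proof -
  let ?T = "\<lambda>k l n. G * U ^ n * A ^ k * B ^ l"
  have z: "cf (const4 (h k l $ n) * ?T k l n) K L N = 0"
    if "k \<ge> 2" "l \<ge> 2" "k \<noteq> k0 \<or> l \<noteq> l0 \<or> n \<noteq> n0" for k l n
    using h[OF that(1,2), of n] that(3) unfolding cf_const4_mult mult_eq_0_iff by blast
  let ?S = "\<lambda>k l. formal_sum (\<lambda>n. const4 (h k l $ n) * ?T k l n)"
  have S0: "cf (?S k l) K L N = 0" if "k \<ge> 2" "l \<ge> 2" "(k, l) \<noteq> (k0, l0)" for k l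
  proof -
    have z': "cf (const4 (h k l $ n) * ?T k l n) K L N = 0" for n
      by (rule z[OF that(1,2)]) (use that(3) in blast)
    show ?thesis
      by (rule trans[OF cf_formal_sum_single[of 0 _ K L N, OF z'] z'])
  qed
  have "cf (formal_sum (\<lambda>(k, l). if k \<ge> 2 \<and> l \<ge> 2 then ?S k l else 0)) K L N
      = cf (case (k0, l0) of (k, l) \<Rightarrow> if k \<ge> 2 \<and> l \<ge> 2 then ?S k l else 0) K L N"
  proof (rule cf_formal_sum_single)
    fix x assume x: "x \<noteq> (k0, l0)"
    obtain k l where kl: "x = (k, l)" by (cases x)
    show "cf (case x of (k, l) \<Rightarrow> if k \<ge> 2 \<and> l \<ge> 2 then ?S k l else 0) K L N = 0"
      using S0[of k l] x unfolding kl by (auto simp del: cf_const4_mult)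
  qed
  also have "\<dots> = cf (?S k0 l0) K L N" using k0 by simp
  also have "\<dots> = cf (const4 (h k0 l0 $ n0) * ?T k0 l0 n0) K L N"
    by (rule cf_formal_sum_single, rule z) (use k0 in auto)
  finally show ?thesis
    unfolding mult_form_at[OF van] cf_add cf_const4_mult by simp
qed

subsection \<open>Comparison of coefficients\<close>

locale admissible_map =
  fixes m :: nat and \<epsilon> \<epsilon>' :: real and h h' :: "nat \<Rightarrow> nat \<Rightarrow> complex fps" and f g :: fps2
  assumes m: "m \<ge> 2" and \<epsilon>': "\<epsilon>' \<noteq> 0"
    and f00: "f $ 0 $ 0 = 0" and g00: "g $ 0 $ 0 = 0"
    and jacobian: "f $ 1 $ 0 * g $ 0 $ 1 - f $ 0 $ 1 * g $ 1 $ 0 \<noteq> 0"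
    and tr: "transforms (f, g) (defining_function m \<epsilon> h) (defining_function m \<epsilon>' h')"
begin

definition \<delta> :: fps4
  where "\<delta> = const4 (\<i> / 2) * (var_w ^ m * form_at \<epsilon> h var_z var_zbar var_w)"
text \<open>Equals \<open>- \<delta>\<close>. The sign is absorbed so that w and cnj w both read
  \<open>var_w\<close> plus a perturbation and share the same support lemmas.\<close>

definition \<delta>' :: fps4
  where "\<delta>' = const4 (- \<i> / 2) * (var_w ^ m * form_at \<epsilon> h var_z var_zbar var_w)"
definition f1 :: fps4 where "f1 = series2 (\<lambda>i j. f $ i $ j) var_z (var_w + \<delta>)"
definition f2 :: fps4 where "f2 = series2 (\<lambda>i j. cnj (f $ i $ j)) var_zbar (var_w + \<delta>')"
definition g1 :: fps4 where "g1 = series2 (\<lambda>i j. g $ i $ j) var_z (var_w + \<delta>)"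
definition g2 :: fps4 where "g2 = series2 (\<lambda>i j. cnj (g $ i $ j)) var_zbar (var_w + \<delta>')"
definition \<gamma> :: fps4 where "\<gamma> = const4 (1 / 2) * (g1 + g2)"
definition rhs :: fps4 where "rhs = form_at \<epsilon>' h' f1 f2 \<gamma>"

lemma identity: "g1 - g2 = const4 \<i> * (\<gamma> ^ m * rhs)"
proof -
  have minus: "var_w + \<delta>' = var_w - \<delta>"
    by (rule fps4_eqI) (simp add: \<delta>_def \<delta>'_def)
  show ?thesis
    using transforms_identity[OF tr f00 g00] m
    unfolding rhs_def \<gamma>_def f1_def f2_def g1_def g2_def minus by (simp add: \<delta>_def)
qed

lemma vanish_var_w_power: "vanish 1 (const4 c * (var_w ^ m * F))"
proof -
  have "vanish (m * 1) (var_w ^ m)" by (intro vanish_power vanish_var)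
  then have "vanish 1 (var_w ^ m)" by (rule vanish_mono) (use m in simp)
  then show ?thesis by (intro vanish_const4_mult vanish_multI1)
qed

lemma vanish_series: "vanish 1 f1" "vanish 1 f2" "vanish 1 \<gamma>"
proof -
  have "vanish 1 (var_w + \<delta>)" "vanish 1 (var_w + \<delta>')"
    unfolding \<delta>_def \<delta>'_def by (intro vanish_add vanish_var vanish_var_w_power)+
  note van = vanish_series2[OF vanish_var(1) this(1)] vanish_series2[OF vanish_var(3) this(2)]
  show "vanish 1 f1" "vanish 1 f2" "vanish 1 \<gamma>"
    unfolding f1_def f2_def \<gamma>_def g1_def g2_def
    by (intro van vanish_const4_mult vanish_add; simp add: f00 g00)+
qed

lemmas supp_rhs_mult = supp_mult_form_at[OF vanish_series, of _ _ h' \<epsilon>', folded rhs_def]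
lemmas cf_rhs_mult = cf_mult_form_at[OF vanish_series, of _ _ h' _ _ _ _ _ \<epsilon>', folded rhs_def]

lemma supp_delta: "fuchsian_below e m h \<Longrightarrow> supp \<delta> (pert m e 1)"
  "fuchsian_below e m h \<Longrightarrow> supp \<delta>' (pert m e 1)"
  unfolding \<delta>_def \<delta>'_def by (rule supp_perturbation, assumption)+

lemma fuchsian_below_0: "fuchsian_below 0 m k"
  by (simp add: fuchsian_below_def)

text \<open>Weight zero imposes nothing, so these supports hold unconditionally.\<close>

lemmas supp0 = supp_delta[OF fuchsian_below_0]

lemma cf_g1: "cf g1 k 0 n = g $ k $ n"
  and cf_f1: "cf f1 k 0 n = f $ k $ n"
  and cf_f2: "cf f2 0 l n = cnj (f $ l $ n)"
  and cf_g2: "cf g2 0 l n = cnj (g $ l $ n)"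
  unfolding f1_def f2_def g1_def g2_def
  using cf_series2_z[OF supp0(1) m] cf_series2_zbar[OF supp0(2) m] by blast+

section \<open>The component g\<close>

lemma supp_f2_ideal: "supp f2 (\<lambda>k l n. l \<ge> 1 \<or> n \<ge> 1)"
  unfolding f2_def
proof (rule supp_series2_zbar[OF supp0(2) m])
  show "1 \<le> i \<or> 1 \<le> j" if "cnj (f $ i $ j) \<noteq> 0" for i j
    using that f00 by (cases "i = 0 \<and> j = 0") auto
  show "1 \<le> i + l \<or> 1 \<le> n" if "pert m 0 j k l n" for i j k l n
    using pert_nonzero[OF that] by linarith
qed

lemma supp_f1_ideal: "supp f1 (\<lambda>k l n. k \<ge> 1 \<or> n \<ge> 1)"
  unfolding f1_def
proof (rule supp_series2_z[OF supp0(1) m])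
  show "1 \<le> i \<or> 1 \<le> j" if "f $ i $ j \<noteq> 0" for i j
    using that f00 by (cases "i = 0 \<and> j = 0") auto
  show "1 \<le> i + k \<or> 1 \<le> n" if "pert m 0 j k l n" for i j k l n
    using pert_nonzero[OF that] by linarith
qed

lemma supp_True: "supp F (\<lambda>_ _ _. True)"
  by (simp add: supp_def)

lemma supp_f2_power_ideal: "l \<ge> 1 \<Longrightarrow> supp (f2 ^ l) (\<lambda>k l n. l \<ge> 1 \<or> n \<ge> 1)"
proof (cases l)
  case (Suc l')
  show ?thesis
    unfolding Suc power_Suc by (rule supp_mult[OF supp_f2_ideal supp_True]) auto
qed simp

text \<open>Every term of the target equation contains a factor \<open>f2\<close>, which lies in the
  ideal of cnj z and u.\<close>

lemma supp_rhs_ideal: "supp rhs (\<lambda>k l n. l \<ge> 1 \<or> n \<ge> 1)"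
proof -
  have "supp (1 * rhs) (\<lambda>k l n. l \<ge> 1 \<or> n \<ge> 1)"
  proof (rule supp_rhs_mult)
    show "supp (1 * (f1 * f2)) (\<lambda>k l n. l \<ge> 1 \<or> n \<ge> 1)"
      by (simp, rule supp_mult[OF supp_True supp_f2_ideal]) auto
    show "supp (1 * \<gamma> ^ n * f1 ^ k * f2 ^ l) (\<lambda>k l n. l \<ge> 1 \<or> n \<ge> 1)" if "l \<ge> 2" for k l n
      by (rule supp_mult[OF supp_True supp_f2_power_ideal]) (use that in auto)
  qed
  then show ?thesis by simp
qed

lemma cf_identity: "cf g1 k l n - cf g2 k l n = \<i> * cf (\<gamma> ^ m * rhs) k l n"
  using arg_cong[OF identity, of "\<lambda>F. cf F k l n"] by simp

lemma cf_g2_0: "k \<ge> 1 \<Longrightarrow> cf g2 k 0 n = 0"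
proof (rule supp_cf_0)
  show "supp g2 (\<lambda>k l n. k = 0 \<or> l \<ge> 1)"
    unfolding g2_def
    by (rule supp_series2_zbar[OF supp0(2) m]) (auto dest: pert_nonzero)
qed auto

text \<open>At cnj z = u = 0 the right side of the identity vanishes, and \<open>g2\<close> has no
  pure power of z. Geometrically, the complex line w = 0 is preserved.\<close>

lemma g_k0: "g $ k $ 0 = 0"
proof (cases "k = 0")
  case False
  have "supp (\<gamma> ^ m * rhs) (\<lambda>k l n. l \<ge> 1 \<or> n \<ge> 1)"
    by (rule supp_mult[OF supp_True supp_rhs_ideal]) auto
  then have "cf (\<gamma> ^ m * rhs) k 0 0 = 0" by (rule supp_cf_0) simp
  then show ?thesis using cf_identity[of k 0 0] cf_g2_0[of k 0] False by (simp add: cf_g1)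
qed (simp add: g00)

text \<open>By \<open>g_k0\<close> the Jacobian matrix is triangular.\<close>

lemma c_q_nonzero: "f $ 1 $ 0 \<noteq> 0" "g $ 0 $ 1 \<noteq> 0"
  using jacobian g_k0[of 1] by auto

lemma pert_n: "pert m e j k l n \<Longrightarrow> n + 1 \<ge> m + j"
  by (simp add: pert_def)

lemma supp_gamma_u: "supp \<gamma> (\<lambda>k l n. n \<ge> 1)"
  unfolding \<gamma>_def g1_def g2_def
proof (intro supp_const4_mult supp_add)
  have j: "1 \<le> j" if "g $ i $ j \<noteq> 0" for i j
    using that g_k0[of i] by (cases j) auto
  have p: "1 \<le> n" if "pert m 0 j k l n" for j k l n
    using pert_n[OF that] m by linarith
  show "supp (series2 (\<lambda>i j. g $ i $ j) var_z (var_w + \<delta>)) (\<lambda>k l n. 1 \<le> n)"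
    by (rule supp_series2_z[OF supp0(1) m]) (auto dest: j p)
  show "supp (series2 (\<lambda>i j. cnj (g $ i $ j)) var_zbar (var_w + \<delta>')) (\<lambda>k l n. 1 \<le> n)"
    by (rule supp_series2_zbar[OF supp0(2) m]) (auto dest: j p)
qed

lemma supp_gamma_u_power: "supp (\<gamma> ^ s) (\<lambda>k l n. n \<ge> s)"
  using supp_power_ge[where F = \<gamma> and a = 0 and b = 0 and c = 1 and d = 1 and s = s] supp_gamma_u by simp

lemma supp_gamma_rhs: "supp (\<gamma> ^ m * rhs) (\<lambda>k l n. n \<ge> m \<and> (l \<ge> 1 \<or> n \<ge> m + 1))"
  by (rule supp_mult[OF supp_gamma_u_power supp_rhs_ideal]) auto

text \<open>Once \<open>\<gamma>\<close> is known to be divisible by u, the terms of the right side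
  free of cnj z start at order m+1.\<close>

lemma g_small:
  assumes "k \<ge> 1" "n \<le> m"
  shows "g $ k $ n = 0"
  using cf_identity[of k 0 n] cf_g2_0[OF assms(1), of n] supp_cf_0[OF supp_gamma_rhs, where k = k and l = 0 and n = n] assms
  by (simp add: cf_g1)

lemma g_01_real: "cnj (g $ 0 $ 1) = g $ 0 $ 1"
  using cf_identity[of 0 0 1] supp_cf_0[OF supp_gamma_rhs, where k = 0 and l = 0 and n = 1] m
  by (simp add: cf_g1 cf_g2)

lemma g_nonzero: "g $ i $ j \<noteq> 0 \<Longrightarrow> j \<ge> 1 \<and> (i = 0 \<or> j \<ge> m + 1)"
  using g_small[of i j] g_k0[of i] by (cases "j = 0"; cases "i = 0"; force simp: not_le)

lemma cf_gamma: "cf \<gamma> 0 0 1 = g $ 0 $ 1"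
  using g_01_real cf_g1[of 0 1] cf_g2[of 0 1] by (simp add: \<gamma>_def)

lemma cf_gamma_power: "cf (\<gamma> ^ s) 0 0 s = (g $ 0 $ 1) ^ s"
proof (induction s)
  case (Suc s)
  have "cf (\<gamma> * \<gamma> ^ s) (0 + 0) (0 + 0) (1 + s) = cf \<gamma> 0 0 1 * cf (\<gamma> ^ s) 0 0 s"
    by (rule cf_mult_unique)
      (use suppD[OF supp_gamma_u] suppD[OF supp_gamma_u_power] in fastforce)
  then show ?case using Suc cf_gamma by simp
qed (simp add: cf_1)

text \<open>Contains the exponents of \<open>\<gamma>^s\<close>.\<close>

definition gam :: "nat \<Rightarrow> nat \<Rightarrow> nat \<Rightarrow> nat \<Rightarrow> nat \<Rightarrow> bool"
  where "gam e s k l n \<longleftrightarrow> (k = 0 \<and> l = 0 \<and> n \<ge> s) \<or> (k = 0 \<or> l = 0) \<and> n \<ge> m + s \<or>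
    k = 1 \<and> l = 1 \<and> n + 1 \<ge> m + s \<or> n + 2 \<ge> 2 * m + s \<or>
    n + 1 \<ge> m + s \<and> (deep m m k l n \<or> k + l + n + n + 1 \<ge> e + m + m + s)"

lemma gam_series:
  "j \<ge> 1 \<Longrightarrow> i = 0 \<or> j \<ge> m + 1 \<Longrightarrow> gam e 1 i 0 j \<and> gam e 1 0 i j"
  "i = 0 \<or> j \<ge> m + 1 \<Longrightarrow> j \<ge> 1 \<Longrightarrow> pert m e j k l n \<Longrightarrow> gam e 1 (i + k) l n \<and> gam e 1 k (i + l) n"
proof -
  show "j \<ge> 1 \<Longrightarrow> i = 0 \<or> j \<ge> m + 1 \<Longrightarrow> gam e 1 i 0 j \<and> gam e 1 0 i j"
    by (auto simp: gam_def)
  assume "i = 0 \<or> j \<ge> m + 1" "j \<ge> 1" and p: "pert m e j k l n"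
  then show "gam e 1 (i + k) l n \<and> gam e 1 k (i + l) n"
  proof (elim disjE)
    assume "j \<ge> m + 1"
    then have "n + 2 \<ge> 2 * m + 1" using pert_n[OF p] by linarith
    then show ?thesis unfolding gam_def by blast
  next
    assume "i = 0" "j \<ge> 1"
    then show ?thesis using p unfolding pert_def gam_def negl_def by auto
  qed
qed

lemma supp_gamma:
  assumes "fuchsian_below e m h"
  shows "supp \<gamma> (gam e 1)"
  unfolding \<gamma>_def g1_def g2_def
proof (intro supp_const4_mult supp_add)
  show "supp (series2 (\<lambda>i j. g $ i $ j) var_z (var_w + \<delta>)) (gam e 1)"
    by (rule supp_series2_z[OF supp_delta(1)[OF assms] m]) (use g_nonzero gam_series in blast)+
  show "supp (series2 (\<lambda>i j. cnj (g $ i $ j)) var_zbar (var_w + \<delta>')) (gam e 1)"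
    by (rule supp_series2_zbar[OF supp_delta(2)[OF assms] m])
      (use g_nonzero gam_series complex_cnj_zero_iff in blast)+
qed

text \<open>Two genuine corrections together have order at least 2m+s-1 and fall under the
  alternative of \<open>gam\<close> on the order alone; otherwise one factor is a power of u and
  only shifts exponents.\<close>

lemma gam_mult:
  assumes "gam e 1 k l n" "gam e s k' l' n'"
  shows "gam e (Suc s) (k + k') (l + l') (n + n')"
proof (cases "k = 0 \<and> l = 0 \<and> n \<ge> 1")
  case True
  show ?thesis
    using assms(2) True deep_mono[of m m k' l' n' "k + k'" "l + l'" 0 "n + n'" m]
    unfolding gam_def by auto
next
  case False
  then have n: "n \<ge> m" using assms(1) unfolding gam_def by auto
  show ?thesis
  proof (cases "k' = 0 \<and> l' = 0 \<and> n' \<ge> s")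
    case True
    show ?thesis
      using assms(1) True n deep_mono[of m m k l n "k + k'" "l + l'" 0 "n + n'" m]
      unfolding gam_def by auto
  next
    case False
    then have "n' + 1 \<ge> m + s" using assms(2) m unfolding gam_def by auto
    then have "(n + n') + 2 \<ge> 2 * m + Suc s" using n by linarith
    then show ?thesis unfolding gam_def by blast
  qed
qed

lemma supp_gamma_power:
  assumes "fuchsian_below e m h"
  shows "supp (\<gamma> ^ s) (gam e s)"
proof (induction s)
  case (Suc s)
  show ?case unfolding power_Suc by (rule supp_mult[OF supp_gamma[OF assms] Suc]) (rule gam_mult)
qed (auto simp: supp_def cf_1 gam_def)

end

text \<open>Expresses that \<open>z^a cnj z^b u^c\<close> is the only monomial of least weight.\<close>

definition lead :: "nat \<Rightarrow> nat \<Rightarrow> nat \<Rightarrow> nat \<Rightarrow> nat \<Rightarrow> nat \<Rightarrow> bool"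
  where "lead a b c k l n \<longleftrightarrow> k = a \<and> l = b \<and> n = c \<or> k + l + n + n > a + b + c + c"

lemma lead_mult: "lead a b c k l n \<Longrightarrow> lead a' b' c' k' l' n' \<Longrightarrow>
    lead (a + a') (b + b') (c + c') (k + k') (l + l') (n + n')"
  unfolding lead_def by (elim disjE) auto

lemma supp_lead_mult:
  "supp F (lead a b c) \<Longrightarrow> supp G (lead a' b' c') \<Longrightarrow> supp (F * G) (lead (a + a') (b + b') (c + c'))"
  by (erule supp_mult, assumption) (rule lead_mult)

lemma cf_lead_mult:
  assumes F: "supp F (lead a b c)" and G: "supp G (lead a' b' c')"
  shows "cf (F * G) (a + a') (b + b') (c + c') = cf F a b c * cf G a' b' c'"
proof (rule cf_mult_unique)
  fix k l n k' l' n'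
  assume "k + k' = a + a'" "l + l' = b + b'" "n + n' = c + c'" "cf F k l n \<noteq> 0" "cf G k' l' n' \<noteq> 0"
  then show "k = a \<and> l = b \<and> n = c"
    using suppD[OF F] suppD[OF G] unfolding lead_def by fastforce
qed

lemma
  assumes F: "supp F (lead a b c)"
  shows supp_lead_power: "supp (F ^ s) (lead (s * a) (s * b) (s * c))"
    and cf_lead_power: "cf (F ^ s) (s * a) (s * b) (s * c) = cf F a b c ^ s"
proof -
  have *: "supp (F ^ s) (lead (s * a) (s * b) (s * c))" for s
  proof (induction s)
    case (Suc s)
    show ?case using supp_lead_mult[OF F Suc] by simp
  qed (simp add: supp_def cf_1 lead_def)
  then show "supp (F ^ s) (lead (s * a) (s * b) (s * c))" .
  show "cf (F ^ s) (s * a) (s * b) (s * c) = cf F a b c ^ s"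
  proof (induction s)
    case (Suc s)
    show ?case using cf_lead_mult[OF F *[of s]] Suc by simp
  qed (simp add: cf_1)
qed

section \<open>Images of single monomials\<close>

context admissible_map
begin

lemma supp_lead_series:
  "supp \<gamma> (lead 0 0 1)" "supp f1 (lead 1 0 0)" "supp f2 (lead 0 1 0)"
proof -
  show "supp \<gamma> (lead 0 0 1)"
    by (rule supp_mono[OF supp_gamma[OF fuchsian_below_0]]) (use m in \<open>auto simp: gam_def lead_def\<close>)
  show "supp f1 (lead 1 0 0)"
    by (rule supp_mono[OF supp_f1_ideal]) (auto simp: lead_def)
  show "supp f2 (lead 0 1 0)"
    by (rule supp_mono[OF supp_f2_ideal]) (auto simp: lead_def)
qed

text \<open>Each substituted series is a nonzero multiple of its variable plus terms of higher
  weight, and leading terms multiply.\<close>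

lemma
  shows supp_term_lead: "supp (\<gamma> ^ N * f1 ^ k * f2 ^ l) (lead k l N)"
    and cf_term_lead: "cf (\<gamma> ^ N * f1 ^ k * f2 ^ l) k l N
      = (g $ 0 $ 1) ^ N * (f $ 1 $ 0) ^ k * cnj (f $ 1 $ 0) ^ l"
proof -
  note s = supp_lead_power[OF supp_lead_series(1), of N] supp_lead_power[OF supp_lead_series(2), of k]
    supp_lead_power[OF supp_lead_series(3), of l]
  note c = cf_lead_power[OF supp_lead_series(1), of N] cf_lead_power[OF supp_lead_series(2), of k]
    cf_lead_power[OF supp_lead_series(3), of l]
  show "supp (\<gamma> ^ N * f1 ^ k * f2 ^ l) (lead k l N)"
    using supp_lead_mult[OF supp_lead_mult[OF s(1,2)] s(3)] by simp
  show "cf (\<gamma> ^ N * f1 ^ k * f2 ^ l) k l N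
      = (g $ 0 $ 1) ^ N * (f $ 1 $ 0) ^ k * cnj (f $ 1 $ 0) ^ l"
    using cf_lead_mult[OF supp_lead_mult[OF s(1,2)] s(3)] cf_lead_mult[OF s(1,2)] c
    by (simp add: cf_gamma[simplified] cf_f1 cf_f2)
qed

text \<open>\<open>f1\<close>, \<open>f2\<close> and \<open>\<gamma>\<close> lie in the ideals of
  (z, u), (cnj z, u) and (u). The four bounded quantities are those occurring in
  \<open>deep\<close>, which is why its ideal is stable.\<close>

lemma supp_term_ge: "supp (\<gamma> ^ N * f1 ^ k * f2 ^ l)
    (\<lambda>k' l' n'. n' \<ge> N \<and> k' + n' \<ge> k + N \<and> l' + n' \<ge> l + N \<and> k' + l' + n' \<ge> k + l + N)"
proof -
  have 1: "supp (f1 ^ k) (\<lambda>k' l' n'. k' + n' \<ge> k)"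
  proof -
    have "supp f1 (\<lambda>k l n. 1 * k + 0 * l + 1 * n \<ge> 1)"
      by (rule supp_mono[OF supp_f1_ideal]) auto
    from supp_power_ge[OF this, of k] show ?thesis by simp
  qed
  have 2: "supp (f2 ^ l) (\<lambda>k' l' n'. l' + n' \<ge> l)"
  proof -
    have "supp f2 (\<lambda>k l n. 0 * k + 1 * l + 1 * n \<ge> 1)"
      by (rule supp_mono[OF supp_f2_ideal]) auto
    from supp_power_ge[OF this, of l] show ?thesis by simp
  qed
  have "supp (\<gamma> ^ N * f1 ^ k) (\<lambda>k' l' n'. n' \<ge> N \<and> k' + n' \<ge> k + N)"
    by (rule supp_mult[OF supp_gamma_u_power 1]) auto
  from supp_mult[OF this 2] show ?thesis by (rule meta_mp) auto
qed

lemma supp_term_deep: "deep m 0 k l n \<Longrightarrow> supp (\<gamma> ^ (s + n) * f1 ^ k * f2 ^ l) (deep m s)"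
  by (rule supp_mono[OF supp_term_ge]) (auto simp: deep_def)

section \<open>The nonlinear part of f\<close>

lemma cf_rhs_mult_zero:
  assumes "\<And>k l n. k \<ge> 2 \<Longrightarrow> l \<ge> 2 \<Longrightarrow> h' k l $ n \<noteq> 0 \<Longrightarrow> cf (G * \<gamma> ^ n * f1 ^ k * f2 ^ l) K L N = 0"
  shows "cf (G * rhs) K L N = of_real \<epsilon>' * cf (G * (f1 * f2)) K L N"
proof -
  \<comment> \<open>The distinguished index (2, 2, 0) is an arbitrary choice, as no index
    contributes.\<close>
  have "cf (G * rhs) K L N = of_real \<epsilon>' * cf (G * (f1 * f2)) K L N
      + h' 2 2 $ 0 * cf (G * \<gamma> ^ 0 * f1 ^ 2 * f2 ^ 2) K L N"
    by (rule cf_rhs_mult) (use assms in auto)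
  then show ?thesis using assms[of 2 2 0] by (cases "h' 2 2 $ 0 = 0") simp_all
qed

text \<open>Compares the coefficients of z^K cnj z u^(m+N), where the left side vanishes. If the
  claim fails at \<open>N\<close>, the terms of \<open>h'\<close> cannot interfere, and by induction
  the right side is a nonzero multiple of \<open>f $ K $ N\<close>. The extra unit in the weight
  bound is the factor cnj z.\<close>

lemma f_coeffs:
  assumes below': "fuchsian_below e m h'" and below: "fuchsian_below e m h" and K: "K \<ge> 2"
  shows "f $ K $ N \<noteq> 0 \<Longrightarrow> N \<ge> m \<or> deep m 0 K 0 N \<or> K + N + N + 1 \<ge> e"
proof (induction N rule: less_induct)
  case (less N)
  show ?case
  proof (rule ccontr)
    assume "\<not> ?thesis"
    then have N: "N < m" "\<not> deep m 0 K 0 N" "K + N + N + 1 < e" by auto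
    have deepK: "\<not> deep m 0 K 1 n" if "n \<le> N" for n
      using N(2) that K unfolding deep_def by auto
    have IH: "f $ K $ n = 0" if "n < N" for n
    proof (rule ccontr)
      assume "f $ K $ n \<noteq> 0"
      from less.IH[OF that this] show False
        using N that deep_mono[of m 0 K 0 n K 0 0 N 0] by auto
    qed
    \<comment> \<open>Below order m the perturbation is absent: \<open>f1\<close> is free of cnj z
      and, by induction, its z^K starts at u^N; \<open>f2\<close> is free of z.\<close>
    have s1: "supp f1 (\<lambda>k l n. l = 0 \<and> (k = K \<longrightarrow> n \<ge> N) \<or> n \<ge> m)"
      unfolding f1_def
    proof (rule supp_series2_z[OF supp0(1) m])
      show "0 = (0 :: nat) \<and> (i = K \<longrightarrow> j \<ge> N) \<or> j \<ge> m" if "f $ i $ j \<noteq> 0" for i j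
        using that IH[of j] by (cases "j < N") auto
      show "l = 0 \<and> (i + k = K \<longrightarrow> n \<ge> N) \<or> n \<ge> m" if "pert m 0 j k l n" "j \<ge> 1" for i j k l n
        using pert_n[OF that(1)] that(2) by auto
    qed
    have s2: "supp f2 (\<lambda>k l n. k = 0 \<or> n \<ge> m)"
      unfolding f2_def
    proof (rule supp_series2_zbar[OF supp0(2) m])
      show "k = 0 \<or> n \<ge> m" if "pert m 0 j k l n" "j \<ge> 1" for j k l n
        using pert_n[OF that(1)] that(2) by auto
    qed auto
    have prod: "cf (f1 * f2) K 1 n = 0" if "n < N" for n
    proof (rule ccontr)
      assume "cf (f1 * f2) K 1 n \<noteq> 0"
      then obtain k l n1 k' l' n2 where "K = k + k'" "1 = l + l'" "n = n1 + n2"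
        "cf f1 k l n1 \<noteq> 0" "cf f2 k' l' n2 \<noteq> 0"
        by (rule cf_mult_nonzero)
      then show False using suppD[OF s1, of k l n1] suppD[OF s2, of k' l' n2] that N by auto
    qed
    have prodN: "cf (f1 * f2) (K + 0) (0 + 1) (N + 0) = cf f1 K 0 N * cf f2 0 1 0"
    proof (rule cf_mult_unique)
      fix k l n k' l' n'
      assume "k + k' = K + 0" "l + l' = 0 + 1" "n + n' = N + 0" "cf f1 k l n \<noteq> 0" "cf f2 k' l' n' \<noteq> 0"
      then show "k = K \<and> l = 0 \<and> n = N"
        using suppD[OF s1, of k l n] suppD[OF s2, of k' l' n'] N by auto
    qed
    \<comment> \<open>The possible terms of \<open>h'\<close> are excluded by weight, by stability
      of the ideal and, for the z^2 cnj z^2 exception, by \<open>N < m\<close>.\<close>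
    have terms: "cf (1 * \<gamma> ^ n * f1 ^ k * f2 ^ l) K 1 n' = 0"
      if n': "n' \<le> N" and kl: "k \<ge> 2" "l \<ge> 2" and nz: "h' k l $ n \<noteq> 0" for k l n n'
    proof (rule ccontr)
      assume "cf (1 * \<gamma> ^ n * f1 ^ k * f2 ^ l) K 1 n' \<noteq> 0"
      then have c: "cf (\<gamma> ^ n * f1 ^ k * f2 ^ l) K 1 n' \<noteq> 0" by simp
      consider "k + l + n + n \<ge> e" | "deep m 0 k l n" | "l = 2" "n + 1 \<ge> m"
        using below' kl nz unfolding fuchsian_below_def permitted_def by blast
      then show False
      proof cases
        case 1
        then show False using suppD[OF supp_term_lead c] kl N n' unfolding lead_def by auto
      next
        case 2
        from supp_term_deep[OF this, of 0] have "supp (\<gamma> ^ n * f1 ^ k * f2 ^ l) (deep m 0)" by simp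
        from suppD[OF this c] show False using deepK[OF n'] by simp
      next
        case 3
        then show False using suppD[OF supp_term_ge c] N n' by auto
      qed
    qed
    have R: "cf rhs K 1 n = of_real \<epsilon>' * cf (f1 * f2) K 1 n" if "n \<le> N" for n
      using cf_rhs_mult_zero[of 1 K 1 n] terms[OF that] by simp
    \<comment> \<open>Only the leading term u^m of \<open>\<gamma> ^ m\<close> can take
      part.\<close>
    have "cf (\<gamma> ^ m * rhs) (0 + K) (0 + 1) (m + N) = cf (\<gamma> ^ m) 0 0 m * cf rhs K 1 N"
    proof (rule cf_mult_unique)
      fix k l n k' l' n'
      assume sum: "k + k' = 0 + K" "l + l' = 0 + 1" "n + n' = m + N"
        and nz: "cf (\<gamma> ^ m) k l n \<noteq> 0" "cf rhs k' l' n' \<noteq> 0"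
      note g = suppD[OF supp_gamma_power[OF below] nz(1)]
      have "n \<ge> m" using suppD[OF supp_gamma_u_power nz(1)] .
      then have n': "n' \<le> N" using sum by simp
      show "k = 0 \<and> l = 0 \<and> n = m"
      proof (cases "k = 0 \<and> l = 0")
        case True
        then have "cf rhs K 1 n' \<noteq> 0" using nz(2) sum by simp
        then have "\<not> n' < N" using R[OF n'] prod by auto
        then show ?thesis using True n' sum by simp
      next
        case False
        have "\<not> deep m m k l n"
          using deepK[OF order_refl] deep_mono[of m m k l n K 1 0 "m + N" m] sum
          by (auto simp: deep_def)
        \<comment> \<open>The correction z cnj z of order at least 2m-1 would leave a pure power of
          z for \<open>rhs\<close>, which has none.\<close>
        moreover have "\<not> (k = 1 \<and> l = 1 \<and> n + 1 \<ge> m + m)"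
        proof
          assume *: "k = 1 \<and> l = 1 \<and> n + 1 \<ge> m + m"
          then have "l' = 0" "n' = 0" using sum N by auto
          then show False using suppD[OF supp_rhs_ideal nz(2)] by simp
        qed
        moreover have "\<not> k + l + n + n + 1 \<ge> e + m + m + m" using sum N m by linarith
        moreover have "\<not> n \<ge> m + m" "\<not> n + 2 \<ge> 2 * m + m" using sum N m by linarith+
        ultimately have False using g False unfolding gam_def by blast
        then show ?thesis ..
      qed
    qed
    then have rhs: "cf (\<gamma> ^ m * rhs) K 1 (m + N)
        = (g $ 0 $ 1) ^ m * (of_real \<epsilon>' * (f $ K $ N * cnj (f $ 1 $ 0)))"
      using R[OF order_refl] prodN by (simp add: cf_gamma_power cf_f1 cf_f2)
    \<comment> \<open>On the left, corrections to terms of g with a factor z have order at least 2m.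
      Corrections to pure powers of w contain cnj z to the first power only in z cnj z, and here
      \<open>K \<ge> 2\<close>.\<close>
    have *: "i = 0 \<or> n \<ge> 2 * m" if "g $ i $ j \<noteq> 0" "pert m 0 j k l n" for i j k l n
      using g_nonzero[OF that(1)] pert_n[OF that(2)] by auto
    have kl: "k = 1 \<and> l = 1 \<or> l \<ge> 2" if "pert m 0 j k l n" for j k l n
      using that by (auto simp: pert_def)
    have "supp g1 (\<lambda>k l n. l = 0 \<or> k = 1 \<and> l = 1 \<or> l \<ge> 2 \<or> n \<ge> 2 * m)"
      unfolding g1_def
    proof (rule supp_series2_z[OF supp0(1) m])
      show "l = 0 \<or> i + k = 1 \<and> l = 1 \<or> l \<ge> 2 \<or> n \<ge> 2 * m"
        if "g $ i $ j \<noteq> 0" "pert m 0 j k l n" for i j k l n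
        using *[OF that] kl[OF that(2)] by auto
    qed simp
    moreover have "supp g2 (\<lambda>k l n. k = 0 \<or> k = 1 \<and> l = 1 \<or> l \<ge> 2 \<or> n \<ge> 2 * m)"
      unfolding g2_def
    proof (rule supp_series2_zbar[OF supp0(2) m])
      show "k = 0 \<or> k = 1 \<and> i + l = 1 \<or> i + l \<ge> 2 \<or> n \<ge> 2 * m"
        if "cnj (g $ i $ j) \<noteq> 0" "pert m 0 j k l n" for i j k l n
        using *[of i j k l n] kl[OF that(2)] that by auto
    qed simp
    ultimately have "cf g1 K 1 (m + N) = 0" "cf g2 K 1 (m + N) = 0"
      using K N by (auto elim!: supp_cf_0)
    then have "cf (\<gamma> ^ m * rhs) K 1 (m + N) = 0" using cf_identity[of K 1 "m + N"] by simp
    then show False using rhs less.prems \<epsilon>' c_q_nonzero by simp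
  qed
qed

end

section \<open>Comparison at weight e\<close>

context admissible_map
begin

context
  fixes e
  assumes below: "fuchsian_below e m h" and below': "fuchsian_below e m h'"
begin

lemma f_nonzero:
  assumes "f $ i $ j \<noteq> 0"
  shows "i \<le> 1 \<or> j \<ge> m \<or> negl m e 0 i 0 j \<or> i \<ge> 2 \<and> i + j + j + 1 \<ge> e"
  using f_coeffs[OF below' below _ assms] negl_deep[of m 0 i 0 j e] by (cases "i \<ge> 2") auto

text \<open>A term at most linear in z acquires a factor z cnj z with order at least m; all other
  corrections are negligible, those of the borderline terms because the perturbation lifts their
  weight above \<open>e\<close>.\<close>

lemma f_series:
  assumes "i \<le> 1 \<or> j \<ge> m \<or> negl m e 0 i 0 j \<or> i \<ge> 2 \<and> i + j + j + 1 \<ge> e"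
    and p: "pert m e j k l n" and j: "j \<ge> 1"
  shows "i + k \<le> 2 \<and> l = 1 \<and> n \<ge> m \<or> negl m e 0 (i + k) l n"
proof -
  have n: "n \<ge> m + j - 1" "n \<ge> j" using pert_n[OF p] m by auto
  show ?thesis
    using assms(1)
  proof (elim disjE)
    assume "i \<le> 1"
    show ?thesis
    proof (cases "k = 1 \<and> l = 1")
      case True
      then show ?thesis using n \<open>i \<le> 1\<close> j by auto
    next
      case False
      then have "k = 2 \<and> l = 2 \<and> n + 2 \<ge> 2 * m + j \<or> negl m e m k l n \<or> k + l + n + n \<ge> e + m + m"
        using p unfolding pert_def by blast
      then have "negl m e 0 k l n"
        using m j by (elim disjE) (auto intro: negl_n negl_weight elim: negl_mono[where t = 0])
      then show ?thesis using negl_mono[of m e 0 k l n "i + k" l 0 n 0] by auto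
    qed
  next
    assume "j \<ge> m"
    then show ?thesis using n m by (intro disjI2 negl_n) linarith
  next
    assume "negl m e 0 i 0 j"
    then show ?thesis using n negl_mono[of m e 0 i 0 j "i + k" l 0 n 0] by simp
  next
    assume "i \<ge> 2 \<and> i + j + j + 1 \<ge> e"
    then show ?thesis using pert_n[OF p] pert_nonzero[OF p] m by (intro disjI2 negl_weight) linarith
  qed
qed

text \<open>The last alternative holds the nonlinear terms in z of weight at least
  \<open>e - 1\<close>, which the induction does not control. In \<open>f1 * f2\<close> they matter
  only with at most one factor cnj z.\<close>

definition f_supp :: "nat \<Rightarrow> nat \<Rightarrow> nat \<Rightarrow> bool"
  where "f_supp k l n \<longleftrightarrow> l = 0 \<and> k \<le> 1 \<or> l = 0 \<and> n \<ge> m \<or> l = 1 \<and> k \<le> 2 \<and> n \<ge> m \<or>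
    negl m e 0 k l n \<or> l = 0 \<and> k \<ge> 2 \<and> k + n + n + 1 \<ge> e"

lemma supp_f1: "supp f1 f_supp"
  unfolding f1_def
proof (rule supp_series2_z[OF supp_delta(1)[OF below] m])
  show "f_supp i 0 j" if "f $ i $ j \<noteq> 0" for i j
    using f_nonzero[OF that] by (auto simp: f_supp_def)
  show "f_supp (i + k) l n" if "f $ i $ j \<noteq> 0" "j \<ge> 1" "pert m e j k l n" for i j k l n
    using f_series[OF f_nonzero[OF that(1)] that(3,2)] by (auto simp: f_supp_def)
qed

lemma supp_f2: "supp f2 (\<lambda>k l. f_supp l k)"
  unfolding f2_def
proof (rule supp_series2_zbar[OF supp_delta(2)[OF below] m])
  have psym: "pert m e j l k n" if "pert m e j k l n" for j k l n
    using that by (auto simp: pert_def negl_def deep_def add_ac)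
  show "f_supp i 0 j" if "cnj (f $ i $ j) \<noteq> 0" for i j
    using f_nonzero[of i j] that by (auto simp: f_supp_def)
  show "f_supp (i + l) k n" if "cnj (f $ i $ j) \<noteq> 0" "j \<ge> 1" "pert m e j k l n" for i j k l n
    using f_series[OF f_nonzero psym[OF that(3)] that(2), of i] that(1) by (auto simp: f_supp_def)
qed

definition ff_supp :: "nat \<Rightarrow> nat \<Rightarrow> nat \<Rightarrow> bool"
  where "ff_supp k l n \<longleftrightarrow> k \<le> 1 \<and> l \<le> 1 \<or> n \<ge> m \<and> (k \<le> 1 \<or> l \<le> 1 \<or> k \<le> 2 \<and> l \<le> 2) \<or>
    negl m e 0 k l n \<or> (k \<le> 1 \<or> l \<le> 1) \<and> k + l + n + n + 1 \<ge> e"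

lemma negl_sym: "negl m e s k l n \<Longrightarrow> negl m e s l k n"
  by (auto simp: negl_def deep_def add_ac)

lemma negl_add1_0: "negl m e 0 k l n \<Longrightarrow> negl m e 0 (k + k') (l + l') (n + n')"
  and negl_add2_0: "negl m e 0 k l n \<Longrightarrow> negl m e 0 (k' + k) (l' + l) (n' + n)"
  by (simp_all add: negl_add1 negl_add2)

lemma f_supp_mult: "f_supp k l n \<Longrightarrow> f_supp l' k' n' \<Longrightarrow> ff_supp (k + k') (l + l') (n + n')"
proof (cases "negl m e 0 k l n \<or> negl m e 0 k' l' n'")
  case True
  then show ?thesis using negl_add1_0 negl_add2_0 unfolding ff_supp_def by blast
next
  case False
  then have "\<not> negl m e 0 l' k' n'" using negl_sym by blast
  moreover assume "f_supp k l n" "f_supp l' k' n'"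
  ultimately show ?thesis
    using False m unfolding f_supp_def ff_supp_def
    by (elim disjE conjE) (simp_all add: negl_n negl_weight)
qed

lemma supp_ff: "supp (f1 * f2) ff_supp"
  by (rule supp_mult[OF supp_f1 supp_f2]) (rule f_supp_mult)

text \<open>Exponents that are never u^m times a forbidden monomial of weight \<open>e\<close>, see
  \<open>not_irrelevant\<close>. The bound on \<open>n\<close> is the permitted order m-1 shifted by
  m.\<close>

definition irrelevant :: "nat \<Rightarrow> nat \<Rightarrow> nat \<Rightarrow> bool"
  where "irrelevant k l n \<longleftrightarrow> k \<le> 1 \<or> l \<le> 1 \<or> k \<le> 2 \<and> l \<le> 2 \<and> n + 1 \<ge> 2 * m \<or> negl m e m k l n"

text \<open>All of \<open>\<gamma> ^ m\<close> has order at least m, so a factor negligible with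
  shift 0 becomes negligible with shift \<open>m\<close>.\<close>

lemma gam_ff:
  assumes "gam e m k l n" "ff_supp k' l' n'"
  shows "irrelevant (k + k') (l + l') (n + n')"
proof (cases "deep m m k l n")
  case True
  then show ?thesis using negl_add1[OF negl_deep] unfolding irrelevant_def by simp
next
  case False
  note nd = this
  have n: "n \<ge> m" using assms(1) m unfolding gam_def by auto
  show ?thesis
  proof (cases "negl m e 0 k' l' n'")
    case True
    then have "negl m e m (k + k') (l + l') (n + n')" by (rule negl_add2) (use n in simp)
    then show ?thesis by (simp add: irrelevant_def)
  next
    case False
    then show ?thesis
      using nd assms m unfolding gam_def ff_supp_def irrelevant_def
      by (elim disjE conjE) (simp_all add: negl_n negl_weight)
  qed
qed

lemma supp_gamma_ff: "supp (\<gamma> ^ m * (f1 * f2)) irrelevant"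
  by (rule supp_mult[OF supp_gamma_power[OF below] supp_ff]) (rule gam_ff)

text \<open>The z^2 cnj z^2 exception. The prefactor has order at least 2m-1; the linear parts of
  the four factors stay within z^2 cnj z^2, and everything else becomes negligible.\<close>

lemma supp_gamma_ffff:
  assumes "n + 1 \<ge> m"
  shows "supp (\<gamma> ^ (m + n) * ((f1 * f1) * (f2 * f2))) irrelevant"
proof -
  \<comment> \<open>Bidegree at most \<open>(a, b)\<close>, up to terms that are negligible after
    multiplication by u^(2m-1).\<close>
  define P where "P a b k l n \<longleftrightarrow> k \<le> a \<and> l \<le> b \<or> n \<ge> m \<or> negl m e 0 k l n \<or> k + l + n + n + 1 \<ge> e"
    for a b k l n :: nat
  have P_mult: "P (a + a') (b + b') (k + k') (l + l') (n + n')" if "P a b k l n" "P a' b' k' l' n'"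
    for a b k l n a' b' k' l' n'
    using that unfolding P_def by (elim disjE) (auto simp: negl_add1_0 negl_add2_0)
  have 1: "supp f1 (P 1 0)"
    by (rule supp_mono[OF supp_f1]) (auto simp: f_supp_def P_def)
  have 2: "supp f2 (P 0 1)"
    by (rule supp_mono[OF supp_f2]) (auto simp: f_supp_def P_def dest: negl_sym)
  have 3: "supp (f1 * f1) (P (1 + 1) (0 + 0))" by (rule supp_mult[OF 1 1]) (rule P_mult)
  have 4: "supp (f2 * f2) (P (0 + 0) (1 + 1))" by (rule supp_mult[OF 2 2]) (rule P_mult)
  have 5: "supp ((f1 * f1) * (f2 * f2)) (P (1 + 1 + (0 + 0)) (0 + 0 + (1 + 1)))"
    by (rule supp_mult[OF 3 4]) (rule P_mult)
  show ?thesis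
  proof (rule supp_mult[OF supp_gamma_power[OF below] 5])
    fix k l n1 k' l' n'
    assume g: "gam e (m + n) k l n1" and p: "P (1 + 1 + (0 + 0)) (0 + 0 + (1 + 1)) k' l' n'"
    show "irrelevant (k + k') (l + l') (n1 + n')"
    proof (cases "k = 0 \<and> l = 0 \<and> n1 \<ge> m + n")
      case True
      show ?thesis
      proof (cases "negl m e 0 k' l' n'")
        case True
        then have "negl m e m (k + k') (l + l') (n1 + n')"
          by (rule negl_add2) (use \<open>k = 0 \<and> l = 0 \<and> n1 \<ge> m + n\<close> in simp)
        then show ?thesis by (simp add: irrelevant_def)
      next
        case False
        then show ?thesis
          using p True assms m unfolding P_def irrelevant_def
          by (elim disjE conjE) (simp_all add: negl_n negl_weight)
      qed
    next
      case False
      then have "n1 + 1 \<ge> m + (m + n)" using g m unfolding gam_def by auto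
      then show ?thesis using assms by (simp add: irrelevant_def negl_n)
    qed
  qed
qed

context
  fixes k0 l0 n0
  assumes kl: "k0 \<ge> 2" "l0 \<ge> 2" and e: "e = k0 + l0 + n0 + n0" and bad: "\<not> permitted m k0 l0 n0"
begin

lemma not_irrelevant: "\<not> irrelevant k0 l0 (m + n0)"
  using kl bad[unfolded permitted_def deep_def] e unfolding irrelevant_def negl_def deep_def by auto

text \<open>By leading weight, a term of \<open>h'\<close> of weight at least \<open>e\<close>
  reaches the monomial only if it is the same monomial. Permitted terms and the Levi term
  \<open>f1 * f2\<close> yield irrelevant exponents only.\<close>

lemma corner_rhs: "cf (\<gamma> ^ m * rhs) k0 l0 (m + n0)
  = h' k0 l0 $ n0 * ((g $ 0 $ 1) ^ (m + n0) * (f $ 1 $ 0) ^ k0 * cnj (f $ 1 $ 0) ^ l0)"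
proof -
  have "cf (\<gamma> ^ m * rhs) k0 l0 (m + n0) = of_real \<epsilon>' * cf (\<gamma> ^ m * (f1 * f2)) k0 l0 (m + n0)
      + h' k0 l0 $ n0 * cf (\<gamma> ^ m * \<gamma> ^ n0 * f1 ^ k0 * f2 ^ l0) k0 l0 (m + n0)"
  proof (rule cf_rhs_mult[OF kl])
    fix k l n
    assume kl': "k \<ge> 2" "l \<ge> 2" and nz: "h' k l $ n \<noteq> 0"
      and "cf (\<gamma> ^ m * \<gamma> ^ n * f1 ^ k * f2 ^ l) k0 l0 (m + n0) \<noteq> 0"
    then have c: "cf (\<gamma> ^ (m + n) * f1 ^ k * f2 ^ l) k0 l0 (m + n0) \<noteq> 0" by (simp add: power_add)
    consider "k + l + n + n \<ge> e" | "deep m 0 k l n" | "k = 2" "l = 2" "n + 1 \<ge> m"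
      using below' kl' nz unfolding fuchsian_below_def permitted_def by blast
    then show "k = k0 \<and> l = l0 \<and> n = n0"
    proof cases
      case 1
      then show ?thesis using suppD[OF supp_term_lead c] unfolding lead_def e by auto
    next
      case 2
      from suppD[OF supp_term_deep[OF this] c] have "irrelevant k0 l0 (m + n0)"
        by (simp add: irrelevant_def negl_deep)
      then show ?thesis using not_irrelevant by simp
    next
      case 3
      have "cf (\<gamma> ^ (m + n) * ((f1 * f1) * (f2 * f2))) k0 l0 (m + n0) \<noteq> 0"
        using c 3 by (simp add: power2_eq_square mult.assoc)
      from suppD[OF supp_gamma_ffff[OF 3(3)] this] show ?thesis using not_irrelevant by simp
    qed
  qed
  moreover have "cf (\<gamma> ^ m * (f1 * f2)) k0 l0 (m + n0) = 0"
    using supp_cf_0[OF supp_gamma_ff not_irrelevant] .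
  ultimately show ?thesis
    using cf_term_lead[of "m + n0" k0 l0] by (simp add: power_add)
qed

lemma cf_delta: "cf \<delta> k0 l0 (m + n0) = \<i> / 2 * h k0 l0 $ n0"
  "cf \<delta>' k0 l0 (m + n0) = - \<i> / 2 * h k0 l0 $ n0"
  using kl by (simp_all add: \<delta>_def \<delta>'_def cf_w_power_mult cf_form_at)

text \<open>A higher power of w, or a factor z with its accompanying w^(m+1), would force an
  exponent below two, a permitted monomial or a negligible one.\<close>

lemma corner_index:
  assumes g: "g $ i $ j \<noteq> 0" and j: "j \<ge> 1" and p: "pert m e j k l (m + n0)"
    and kl': "k0 = i + k \<and> l0 = l \<or> k0 = k \<and> l0 = i + l"
  shows "i = 0 \<and> j = 1"
proof -
  have nn: "\<not> negl m e m k0 l0 (m + n0)" using not_irrelevant by (simp add: irrelevant_def)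
  have "\<not> negl m e m k l (m + n0)"
    using nn negl_mono[of m e m k l "m + n0" k0 l0 0 "m + n0" m] kl' by auto
  moreover have "\<not> (k = 1 \<and> l = 1)" if "i = 0" using kl kl' that by auto
  moreover have "n0 + 2 < 2 * m" using bad unfolding permitted_def deep_def by auto
  moreover have "\<not> (k0 = 2 \<and> l0 = 2 \<and> n0 + 1 \<ge> m)" using bad unfolding permitted_def by auto
  ultimately show ?thesis
    using g_nonzero[OF g] p kl kl' j unfolding pert_def by auto
qed

lemma corner_lhs:
  "cf g1 k0 l0 (m + n0) = g $ 0 $ 1 * (\<i> / 2 * h k0 l0 $ n0)"
  "cf g2 k0 l0 (m + n0) = g $ 0 $ 1 * (- \<i> / 2 * h k0 l0 $ n0)"
proof -
  have "cf g1 k0 l0 (m + n0) = g $ 0 $ 1 * cf (var_z ^ 0 * (var_w + \<delta>) ^ 1) k0 l0 (m + n0)"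
    unfolding g1_def
  proof (rule cf_series2_single)
    fix i j assume "g $ i $ j \<noteq> 0" "cf (var_z ^ i * (var_w + \<delta>) ^ j) k0 l0 (m + n0) \<noteq> 0"
    with suppD[OF supp_z_mult(1)[OF supp_delta(1)[OF below] m] this(2)] kl
    show "i = 0 \<and> j = 1" using corner_index[of i j] by auto
  qed
  then show "cf g1 k0 l0 (m + n0) = g $ 0 $ 1 * (\<i> / 2 * h k0 l0 $ n0)"
    using cf_delta(1) cf_w[of 1] kl by simp
  have "cf g2 k0 l0 (m + n0) = cnj (g $ 0 $ 1) * cf (var_zbar ^ 0 * (var_w + \<delta>') ^ 1) k0 l0 (m + n0)"
    unfolding g2_def
  proof (rule cf_series2_single)
    fix i j assume "cnj (g $ i $ j) \<noteq> 0" "cf (var_zbar ^ i * (var_w + \<delta>') ^ j) k0 l0 (m + n0) \<noteq> 0"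
    with suppD[OF supp_z_mult(2)[OF supp_delta(2)[OF below] m] this(2)] kl
    show "i = 0 \<and> j = 1" using corner_index[of i j] by auto
  qed
  then show "cf g2 k0 l0 (m + n0) = g $ 0 $ 1 * (- \<i> / 2 * h k0 l0 $ n0)"
    using cf_delta(2) cf_w[of 1] kl g_01_real by simp
qed

text \<open>With c and q the diagonal entries of the Jacobian matrix, q h equals h' times q^(m+n0)
  c^k0 (cnj c)^l0, and both factors are nonzero.\<close>

lemma corner_iff: "h k0 l0 $ n0 = 0 \<longleftrightarrow> h' k0 l0 $ n0 = 0"
proof -
  have "\<i> * (g $ 0 $ 1 * h k0 l0 $ n0) = \<i> * cf (\<gamma> ^ m * rhs) k0 l0 (m + n0)"
    using cf_identity[of k0 l0 "m + n0"] unfolding corner_lhs by (simp add: field_simps)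
  then have "g $ 0 $ 1 * h k0 l0 $ n0
    = h' k0 l0 $ n0 * ((g $ 0 $ 1) ^ (m + n0) * (f $ 1 $ 0) ^ k0 * cnj (f $ 1 $ 0) ^ l0)"
    unfolding corner_rhs by simp
  then show ?thesis using c_q_nonzero by auto
qed

end

end

text \<open>The step from \<open>e\<close> to \<open>Suc e\<close> adds exactly the forbidden
  coefficients of weight \<open>e\<close>. As \<open>corner_iff\<close> is an equivalence, the same
  map serves both directions.\<close>

lemma fuchsian_below_iff: "fuchsian_below e m h \<longleftrightarrow> fuchsian_below e m h'"
proof (induction e)
  case 0
  show ?case by (simp add: fuchsian_below_0)
next
  case (Suc e)
  have *: "fuchsian_below (Suc e) m k \<longleftrightarrow> fuchsian_below e m k \<and>
    (\<forall>k0 l0 n0. k0 \<ge> 2 \<longrightarrow> l0 \<ge> 2 \<longrightarrow> e = k0 + l0 + n0 + n0 \<longrightarrow> \<not> permitted m k0 l0 n0 \<longrightarrow> k k0 l0 $ n0 = 0)" for k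
  proof -
    have "Suc e \<le> x \<longleftrightarrow> e \<le> x \<and> e \<noteq> x" for x by auto
    then show ?thesis unfolding fuchsian_below_def by blast
  qed
  show ?case
    unfolding * using Suc.IH corner_iff by blast
qed

end

section \<open>Fuchsian type in terms of permitted monomials\<close>

lemma vanishing_order_ge: "vanishing_order F \<ge> enat N \<longleftrightarrow> (\<forall>n<N. F $ n = 0)"
proof (cases "F = 0")
  case False
  then have "N \<le> subdegree F \<longleftrightarrow> (\<forall>n<N. F $ n = 0)"
    by (auto intro: subdegree_geI nth_less_subdegree_zero)
  then show ?thesis using False by (simp add: vanishing_order_def)
qed (simp add: vanishing_order_def)

text \<open>When exactly one index is two, \<open>fuchsian_type\<close> constrains only one of
  \<open>h k l\<close> and \<open>h l k\<close>; the reality condition supplies the other.\<close>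

lemma fuchsian_type_iff:
  assumes adm: "admissible_form m \<epsilon> h"
  shows "fuchsian_type m h \<longleftrightarrow> (\<forall>k l n. k \<ge> 2 \<longrightarrow> l \<ge> 2 \<longrightarrow> h k l $ n \<noteq> 0 \<longrightarrow> permitted m k l n)"
    (is "_ \<longleftrightarrow> ?P")
proof
  assume ft: "fuchsian_type m h"
  have le: "permitted m k l n" if "k \<ge> 2" "k \<le> l" "h k l $ n \<noteq> 0" for k l n
  proof (rule ccontr)
    assume bad: "\<not> permitted m k l n"
    then have n: "n + 2 < 2 * m" "n + l < 2 * m + 2" "n + k + l < 2 * m + 5"
      "\<not> (k = 2 \<and> l = 2 \<and> n + 1 \<ge> m)"
      by (auto simp: permitted_def deep_def)
    have *: "\<not> vanishing_order (h k l) \<ge> enat N" if "n < N" for N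
      using that \<open>h k l $ n \<noteq> 0\<close> vanishing_order_ge by blast
    \<comment> \<open>The five families of the definition. Its upper bounds on the indices hold
      because the monomial would otherwise be permitted.\<close>
    have "k = 2 \<and> l = 2 \<or> k = 2 \<and> l = 3 \<or> k = 3 \<and> l = 3 \<or> k = 2 \<and> l \<ge> 4 \<or> k \<ge> 3 \<and> k + l \<ge> 7"
      using that(1,2) by arith
    then consider "k = 2" "l = 2" | "k = 2" "l = 3" | "k = 3" "l = 3" | "k = 2" "l \<ge> 4" | "k \<ge> 3" "k + l \<ge> 7"
      by blast
    then show False
    proof cases
      case 1
      then show False using *[of "m - 1"] n ft unfolding fuchsian_type_def by force
    next
      case 2
      then show False using *[of "2 * m - 2"] n ft unfolding fuchsian_type_def by force
    next
      case 3
      then show False using *[of "2 * m - 2"] n ft unfolding fuchsian_type_def by force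
    next
      case 4
      then have "vanishing_order (h k l) \<ge> enat (2 * m + 2 - l)"
        using n ft unfolding fuchsian_type_def by auto
      moreover have "n < 2 * m + 2 - l" using n(2) by arith
      ultimately show False using * by blast
    next
      case 5
      then have "vanishing_order (h k l) \<ge> enat (2 * m + 5 - (k + l))"
        using n that(2) ft unfolding fuchsian_type_def by auto
      moreover have "n < 2 * m + 5 - (k + l)" using n(3) by arith
      ultimately show False using * by blast
    qed
  qed
  show ?P
  proof (intro allI impI)
    fix k l n assume kl: "k \<ge> 2" "l \<ge> 2" and nz: "h k l $ n \<noteq> 0"
    show "permitted m k l n"
    proof (cases "k \<le> l")
      case False
      have "h l k $ n = cnj (h k l $ n)"
        using real_series_coeffs[of m \<epsilon> h k l n] kl adm by (simp add: admissible_form_def)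
      then have "permitted m l k n" using le[of l k n] False kl nz by simp
      then show ?thesis by (auto simp: permitted_def deep_def add_ac)
    qed (use le kl nz in blast)
  qed
next
  assume P: ?P
  have *: "vanishing_order (h k l) \<ge> enat N"
    if "k \<ge> 2" "l \<ge> 2" "\<And>n. n < N \<Longrightarrow> \<not> permitted m k l n" for k l N
    unfolding vanishing_order_ge using P that by blast
  show "fuchsian_type m h"
    unfolding fuchsian_type_def
    by (intro conjI allI impI; rule *) (auto simp: permitted_def deep_def)
qed

text \<open>Every monomial has finite weight, so a forbidden one is detected at the next
  weight.\<close>

lemma fuchsian_type_iff_below:
  assumes "admissible_form m \<epsilon> h"
  shows "fuchsian_type m h \<longleftrightarrow> (\<forall>e. fuchsian_below e m h)"
proof -
  have "(\<forall>e. fuchsian_below e m h) \<longleftrightarrow>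
      (\<forall>k l n. k \<ge> 2 \<longrightarrow> l \<ge> 2 \<longrightarrow> h k l $ n \<noteq> 0 \<longrightarrow> permitted m k l n)"
    unfolding fuchsian_below_def by (metis Suc_n_not_le_n)
  then show ?thesis using fuchsian_type_iff[OF assms] by simp
qed

theorem theorem4:
  fixes m :: nat
    and \<epsilon> \<epsilon>' :: real
    and h h' :: "nat \<Rightarrow> nat \<Rightarrow> complex fps"
    and H :: "complex fps fps \<times> complex fps fps"
  assumes "admissible_form m \<epsilon> h"
    and "convergent_series (admissible_rhs m \<epsilon> h)"
    and "admissible_form m \<epsilon>' h'"
    and "formal_coordinate_change H"
    and "transforms H (defining_function m \<epsilon> h) (defining_function m \<epsilon>' h')"
  shows "fuchsian_type m h \<longleftrightarrow> fuchsian_type m h'"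
proof (cases "m = 1")
  \<comment> \<open>All lower bounds are then zero or range over empty index sets.\<close>
  case True
  then show ?thesis by (simp add: fuchsian_type_def vanishing_order_ge)
next
  case False
  obtain f g where H: "H = (f, g)" by (cases H)
  interpret admissible_map m \<epsilon> \<epsilon>' h h' f g
    using assms False unfolding admissible_map_def admissible_form_def formal_coordinate_change_def H
    by auto
  show ?thesis
    unfolding fuchsian_type_iff_below[OF assms(1)] fuchsian_type_iff_below[OF assms(3)]
      fuchsian_below_iff ..
qed

end
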